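(* Let $q>3$ and $\tau\in\{132,321,213\}$. For each $n\in\mathbb{N}$ let $\Pi_n$ be a random permutation in $\mathcal{S}_n(\tau)$ distributed according to $\mathbb{P}_n^{q,\tau}$, i.e. $\mathbb{P}(\Pi_n=\sigma)=q^{\mathrm{fp}(\sigma)}/Z_n(q,\tau)$ for $\sigma\in\mathcal{S}_n(\tau)$, where $Z_n(q,\tau)=\sum_{\sigma\in\mathcal{S}_n(\tau)}q^{\mathrm{fp}(\sigma)}$. Then as $n\to\infty$, \[ \frac{\mathrm{fp}(\Pi_n)-\frac{q(q-3)}{(q-1)(q-2)}n}{\sqrt{\frac{2q(2q-3)}{(q-1)^2(q-2)^2}n}} \] converges in distribution to a standard normal random variable.
   Context: $\mathcal{S}_n$ denotes the set of permutations of $\{1,\dots,n\}$, written in one-line notation $\sigma=\sigma_1\cdots\sigma_n$. For $\sigma\in\mathcal{S}_n$, $\mathrm{fp}(\sigma)$ is the number of $i$ with $\sigma_i=i$. For $\tau\in\mathcal{S}_m$ with $2\le m\le n$, $\sigma$ contains the pattern $\tau$ if there are indices $1\le i_1<\cdots<i_m\le n$ such that for all $j,k$, $\sigma_{i_j}<\sigma_{i_k}$ iff $\tau_j<\tau_k$; otherwise $\sigma$ avoids $\tau$ (and if $m>n$ every $\sigma\in\mathcal{S}_n$ avoids $\tau$). $\mathcal{S}_n(\tau)$ is the set of $\sigma\in\mathcal{S}_n$ avoiding $\tau$. *)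

theory Defs
  imports "HOL-Probability.Probability" "HOL-Combinatorics.Multiset_Permutations"
begin

text \<open>Permutations of {1..n} in one-line notation: lists sigma with sigma ! (i-1) = sigma_i.\<close>

definition Sn :: "nat \<Rightarrow> nat list set" where
  "Sn n = permutations_of_set {1..n}"

definition fp :: "nat list \<Rightarrow> nat" where
  "fp \<sigma> = card {i \<in> {1..length \<sigma>}. \<sigma> ! (i - 1) = i}"

definition contains :: "nat list \<Rightarrow> nat list \<Rightarrow> bool" where
  "contains \<sigma> \<tau> \<longleftrightarrow> (\<exists>idx. length idx = length \<tau> \<and> sorted_wrt (<) idx \<and>
      (\<forall>i\<in>set idx. i < length \<sigma>) \<and>
      (\<forall>j<length \<tau>. \<forall>k<length \<tau>. \<sigma> ! (idx ! j) < \<sigma> ! (idx ! k) \<longleftrightarrow> \<tau> ! j < \<tau> ! k))"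

definition avoiders :: "nat \<Rightarrow> nat list \<Rightarrow> nat list set" where
  "avoiders n \<tau> = {\<sigma> \<in> Sn n. \<not> contains \<sigma> \<tau>}"

definition Zn :: "nat \<Rightarrow> real \<Rightarrow> nat list \<Rightarrow> real" where
  "Zn n q \<tau> = (\<Sum>\<sigma>\<in>avoiders n \<tau>. q ^ fp \<sigma>)"

definition Pn :: "nat \<Rightarrow> real \<Rightarrow> nat list \<Rightarrow> nat list measure" where
  "Pn n q \<tau> = density (count_space (avoiders n \<tau>)) (\<lambda>\<sigma>. ennreal (q ^ fp \<sigma> / Zn n q \<tau>))"

end

theory Submission
  imports Defs
begin

text \<open>
  For each of the three patterns the weighted count of avoiders is
  \<open>Zn n q = (\<Sum>k\<le>n. (q - 1)^k * B n k)\<close> with the ballot numbers \<open>B n k = [x^(n-k)] C(x)^(k+1)\<close>, where \<open>C\<close>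
  is the Catalan generating function: \<open>B n k\<close> counts the avoiders with \<open>k\<close> marked fixed points.
  Substituting \<open>j = n - k\<close>, the sum is a partial sum of a negative binomial series in
  \<open>r = 1 / (q - 1)\<close>. For \<open>q > 3\<close> we have \<open>|r| < 1/2\<close>, the partial sum contains almost all of the
  series, and \<open>Zn n w\<close> is asymptotic to a constant times \<open>((w - 1)^2 / (w - 2))^n\<close>, uniformly for
  complex \<open>w\<close> near \<open>q\<close>. The characteristic function of the number of fixed points is a quotient
  \<open>Zn n (q * exp (\<i> * \<theta>)) / Zn n q\<close>, so the second-order expansion of
  \<open>Ln ((w - 1)^2 / (w - 2))\<close> at \<open>w = q * exp (\<i> * \<theta>)\<close> and Levy's continuity theorem give the limit law.
\<close>

subsection \<open>Ballot numbers\<close>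

text \<open>\<open>ballot k m\<close> is the coefficient of \<open>x^m\<close> in \<open>C(x)^k\<close>, where \<open>C = 1 + x C^2\<close> is the
  Catalan generating function; the recursion is \<open>C^(k+1) = C^k + x C^(k+2)\<close>.\<close>

fun ballot :: "nat \<Rightarrow> nat \<Rightarrow> nat" where
  "ballot 0 0 = 1"
| "ballot 0 (Suc m) = 0"
| "ballot (Suc k) 0 = 1"
| "ballot (Suc k) (Suc m) = ballot k (Suc m) + ballot (Suc (Suc k)) m"

lemma ballot_0_right [simp]: "ballot k 0 = 1"
  by (cases k) auto

text \<open>Coefficientwise \<open>C^j * C^k = C^(j+k)\<close>; both sides obey the recursion of
  \<open>ballot\<close> in \<open>j\<close>, with \<open>k\<close> fixed.\<close>

lemma ballot_convolution: "(\<Sum>i\<le>m. ballot j i * ballot k (m - i)) = ballot (j + k) m"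
proof (induction j m rule: ballot.induct)
  case (2 m)
  have "(\<Sum>i\<le>Suc m. ballot 0 i * ballot k (Suc m - i)) = (\<Sum>i\<in>{0}. ballot 0 i * ballot k (Suc m - i))"
    by (rule sum.mono_neutral_right) (auto elim: ballot.elims simp: gr0_conv_Suc)
  then show ?case by simp
next
  case (4 j m)
  then show ?case
    by (simp add: sum.atMost_Suc_shift algebra_simps sum.distrib del: sum.atMost_Suc)
qed auto

abbreviation catalan :: "nat \<Rightarrow> nat" where
  "catalan \<equiv> ballot 1"

text \<open>The recursion becomes Pascal's rule. The difference of two binomials is stated as a sum
  to avoid truncated subtraction.\<close>

lemma ballot_closed:
  "ballot (Suc k) m + (if m = 0 then 0 else (2 * m + k) choose (m - 1)) = (2 * m + k) choose m"
proof (induction "Suc k" m arbitrary: k rule: ballot.induct)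
  case (4 k m)
  show ?case
  proof (cases k)
    case 0
    \<comment> \<open>Here the recursion ends at \<open>ballot 0 (Suc m) = 0\<close>, and the
      symmetry of the middle binomials replaces the first induction hypothesis.\<close>
    have s: "(m + m + 1) choose m = (m + m + 1) choose (Suc m)"
      using binomial_symmetric[of m "m + m + 1"] by simp
    from 4(2) 0 s show ?thesis
      by (cases m) (auto simp: algebra_simps numeral_2_eq_2)
  next
    case (Suc l)
    from 4(1)[OF Suc] 4(2) Suc show ?thesis
      by (cases m) (auto simp: algebra_simps numeral_2_eq_2)
  qed
qed auto

lemma sum_triangle_swap:
  fixes f :: "nat \<Rightarrow> nat \<Rightarrow> 'a::comm_monoid_add"
  shows "(\<Sum>i\<le>N. \<Sum>k\<le>N - i. f i k) = (\<Sum>k\<le>N. \<Sum>i\<le>N - k. f i k)"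
  by (simp add: sum.Sigma)
     (rule sum.reindex_bij_witness[of _ "\<lambda>(a, b). (b, a)" "\<lambda>(a, b). (b, a)"], auto)

text \<open>The coefficient of \<open>x^n\<close> in \<open>C / (1 - p x C)\<close>.\<close>

definition ballot_poly :: "'a::comm_ring_1 \<Rightarrow> nat \<Rightarrow> 'a" where
  "ballot_poly p n = (\<Sum>k\<le>n. of_nat (ballot (Suc k) (n - k)) * p ^ k)"

text \<open>With \<open>B = C / (1 - p x C)\<close> this is the coefficient form of
  \<open>B = C + p x C B\<close>.\<close>

lemma ballot_poly_rec:
  "ballot_poly p n = of_nat (catalan n) + p * (\<Sum>i<n. of_nat (catalan i) * ballot_poly p (n - Suc i))"
proof (cases n)
  case 0
  then show ?thesis by (simp add: ballot_poly_def)
next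
  case (Suc N)
  have conv: "(\<Sum>i\<le>N - k. catalan i * ballot (Suc k) (N - (i + k))) = ballot (Suc (Suc k)) (N - k)" for k
    using ballot_convolution[of 1 "Suc k" "N - k"] by (simp add: add.commute)
  have "(\<Sum>i<n. of_nat (catalan i) * ballot_poly p (n - Suc i))
      = (\<Sum>i\<le>N. \<Sum>k\<le>N - i. of_nat (catalan i * ballot (Suc k) (N - (i + k))) * p ^ k)"
    by (simp add: Suc lessThan_Suc_atMost ballot_poly_def sum_distrib_left mult.assoc)
  also have "\<dots> = (\<Sum>k\<le>N. \<Sum>i\<le>N - k. of_nat (catalan i * ballot (Suc k) (N - (i + k))) * p ^ k)"
    by (rule sum_triangle_swap)
  also have "\<dots> = (\<Sum>k\<le>N. of_nat (ballot (Suc (Suc k)) (N - k)) * p ^ k)"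
    by (simp only: sum_distrib_right[symmetric] of_nat_sum[symmetric] conv)
  finally show ?thesis
    by (simp add: Suc ballot_poly_def sum.atMost_Suc_shift sum_distrib_left algebra_simps del: sum.atMost_Suc)
qed

subsection \<open>Patterns of length three\<close>

text \<open>A pattern is encoded as a predicate on three values in order of position, so that
  shifts, reversals and complements act on the predicate.\<close>

fun avoids3 :: "('a \<Rightarrow> 'a \<Rightarrow> 'a \<Rightarrow> bool) \<Rightarrow> 'a list \<Rightarrow> bool" where
  "avoids3 P [] = True"
| "avoids3 P (x # xs) \<longleftrightarrow> sorted_wrt (\<lambda>y z. \<not> P x y z) xs \<and> avoids3 P xs"

lemma avoids3_conv_nth:
  "avoids3 P xs \<longleftrightarrow> (\<forall>i j k. i < j \<longrightarrow> j < k \<longrightarrow> k < length xs \<longrightarrow> \<not> P (xs ! i) (xs ! j) (xs ! k))"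
proof (induction xs)
  case (Cons x xs)
  show ?case
  proof
    assume "avoids3 P (x # xs)"
    then show "\<forall>i j k. i < j \<longrightarrow> j < k \<longrightarrow> k < length (x # xs) \<longrightarrow>
        \<not> P ((x # xs) ! i) ((x # xs) ! j) ((x # xs) ! k)"
      by (auto simp: Cons.IH sorted_wrt_iff_nth_less nth_Cons split: nat.splits)
  next
    assume R: "\<forall>i j k. i < j \<longrightarrow> j < k \<longrightarrow> k < length (x # xs) \<longrightarrow>
        \<not> P ((x # xs) ! i) ((x # xs) ! j) ((x # xs) ! k)"
    have "\<not> P x (xs ! j) (xs ! k)" if "j < k" "k < length xs" for j k
      using R[rule_format, of 0 "Suc j" "Suc k"] that by simp
    moreover have "\<not> P (xs ! i) (xs ! j) (xs ! k)" if "i < j" "j < k" "k < length xs" for i j k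
      using R[rule_format, of "Suc i" "Suc j" "Suc k"] that by simp
    ultimately show "avoids3 P (x # xs)"
      by (simp add: Cons.IH sorted_wrt_iff_nth_less)
  qed
qed auto

lemma avoids3_append:
  "avoids3 P (xs @ ys) \<longleftrightarrow> avoids3 P xs \<and> avoids3 P ys
     \<and> (\<forall>x\<in>set xs. sorted_wrt (\<lambda>y z. \<not> P x y z) ys)
     \<and> sorted_wrt (\<lambda>x y. \<forall>z\<in>set ys. \<not> P x y z) xs"
  by (induction xs) (auto simp: sorted_wrt_append)

lemma avoids3_map: "avoids3 P (map f xs) \<longleftrightarrow> avoids3 (\<lambda>x y z. P (f x) (f y) (f z)) xs"
  by (induction xs) (auto simp: sorted_wrt_map)

lemma avoids3_rev: "avoids3 P (rev xs) \<longleftrightarrow> avoids3 (\<lambda>x y z. P z y x) xs"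
  by (induction xs) (auto simp: avoids3_append sorted_wrt_rev)

lemma avoids3_cong:
  assumes "\<And>x y z. x \<in> set xs \<Longrightarrow> y \<in> set xs \<Longrightarrow> z \<in> set xs \<Longrightarrow> P x y z \<longleftrightarrow> Q x y z"
  shows "avoids3 P xs \<longleftrightarrow> avoids3 Q xs"
proof -
  have "avoids3 P xs \<Longrightarrow> avoids3 Q xs"
    if "\<And>x y z. x \<in> set xs \<Longrightarrow> y \<in> set xs \<Longrightarrow> z \<in> set xs \<Longrightarrow> Q x y z \<Longrightarrow> P x y z" for P Q
    using that by (induction xs) (auto elim!: sorted_wrt_mono_rel[rotated])
  from this[of Q P] this[of P Q] show ?thesis using assms by blast
qed

text \<open>Permutations are shifted here to the value set \<open>{..<n}\<close>, so that a fixed point is an index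
  \<open>i\<close> with \<open>xs ! i = i\<close>.\<close>

definition avoiding :: "(nat \<Rightarrow> nat \<Rightarrow> nat \<Rightarrow> bool) \<Rightarrow> nat \<Rightarrow> nat list set" where
  "avoiding P n = {xs. set xs = {..<n} \<and> distinct xs \<and> avoids3 P xs}"

lemma avoiding_conv_permutations: "avoiding P n = {xs \<in> permutations_of_set {..<n}. avoids3 P xs}"
  by (auto simp: avoiding_def permutations_of_set_def)

lemma finite_avoiding [simp]: "finite (avoiding P n)"
  by (simp add: avoiding_conv_permutations)

lemma avoiding_0 [simp]: "avoiding P 0 = {[]}"
  by (auto simp: avoiding_def)

lemma length_avoiding: "xs \<in> avoiding P n \<Longrightarrow> length xs = n"
  using distinct_card[of xs] by (auto simp: avoiding_def)

lemma sorted_wrt_if_all: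
  "(\<And>y z. y \<in> set xs \<Longrightarrow> z \<in> set xs \<Longrightarrow> R y z) \<Longrightarrow> sorted_wrt R xs"
  by (induction xs) auto

lemma set_map_add:
  fixes a :: nat
  shows "set xs = {..<m} \<Longrightarrow> set (map (\<lambda>x. x + a) xs) = {a..<a + m}"
  using image_add_atLeastLessThan'[of a 0 m] by (simp add: lessThan_atLeast0 add.commute)

text \<open>Order patterns are translation invariant; this gives surjectivity in the splittings
  below.\<close>

lemma avoiding_shift:
  assumes P: "\<And>x y z. P (x + a) (y + a) (z + a) \<longleftrightarrow> P x y z"
    and xs: "set xs = {a..<a + n}" "distinct xs" "avoids3 P xs"
  obtains ys where "ys \<in> avoiding P n" "xs = map (\<lambda>x. x + a) ys"
proof -
  define ys where "ys = map (\<lambda>x. x - a) xs"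
  have "map (\<lambda>x. x + a) ys = map id xs"
    unfolding ys_def map_map by (rule map_cong) (use xs in auto)
  then have eq: "xs = map (\<lambda>x. x + a) ys" by simp
  have "set ys = {..<n}"
    unfolding ys_def using xs(1) by (auto simp: image_iff intro!: bexI[of _ "_ + a"])
  moreover have "distinct ys" using xs(2) by (simp add: eq distinct_map)
  moreover have "avoids3 P ys" using xs(3) by (simp add: eq avoids3_map P)
  ultimately show ?thesis using eq that by (simp add: avoiding_def)
qed

lemma down_closed_eq_lessThan:
  fixes B :: "nat set"
  assumes "finite B" "\<And>x y. y \<in> B \<Longrightarrow> x < y \<Longrightarrow> x \<in> B"
  shows "B = {..<card B}"
proof (cases "B = {}")
  case False
  have "B = {..<Suc (Max B)}"
  proof (intro equalityI subsetI)
    fix x assume "x \<in> B"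
    then show "x \<in> {..<Suc (Max B)}" using assms(1) by (simp add: less_Suc_eq_le)
  next
    fix x assume "x \<in> {..<Suc (Max B)}"
    then show "x \<in> B" using assms(2)[of "Max B" x] Max_in[OF assms(1) False]
      by (auto simp: less_Suc_eq)
  qed
  then show ?thesis by (metis card_lessThan)
qed simp

text \<open>Splitting a permutation shifts positions and values of its pieces by different amounts, so
  fixed points of the whole become \<open>d\<close>-hits, \<open>xs ! i = i + d\<close>, of the pieces.\<close>

fun hits :: "int \<Rightarrow> nat list \<Rightarrow> nat" where
  "hits d [] = 0"
| "hits d (x # xs) = of_bool (int x = d) + hits (d + 1) xs"

lemma hits_append: "hits d (xs @ ys) = hits d xs + hits (d + int (length xs)) ys"
  by (induction xs arbitrary: d) (auto simp: algebra_simps)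

lemma hits_shift: "hits d (map (\<lambda>x. x + a) xs) = hits (d - int a) xs"
  by (induction xs arbitrary: d) (auto simp: algebra_simps)

lemma hit_set_Cons:
  "{i. i < length (x # xs) \<and> int ((x # xs) ! i) = int i + d}
     = (if int x = d then {0} else {}) \<union> Suc ` {i. i < length xs \<and> int (xs ! i) = int i + (d + 1)}"
proof (rule set_eqI)
  fix i show "i \<in> {i. i < length (x # xs) \<and> int ((x # xs) ! i) = int i + d} \<longleftrightarrow>
    i \<in> (if int x = d then {0} else {}) \<union> Suc ` {i. i < length xs \<and> int (xs ! i) = int i + (d + 1)}"
    by (cases i) auto
qed

lemma hits_conv_card: "hits d xs = card {i. i < length xs \<and> int (xs ! i) = int i + d}"
proof (induction xs arbitrary: d)
  case (Cons x xs)
  show ?case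
    unfolding hit_set_Cons by (auto simp: Cons.IH card_image card_insert_if)
qed auto

text \<open>Choosing a subset of the hits, each chosen hit with weight \<open>w - 1\<close>, gives \<open>w ^ hits\<close>; the
  sum is over the first chosen hit.\<close>

lemma hits_power_expand:
  fixes w :: "'a::comm_ring_1"
  shows "w ^ hits d xs = 1 + (w - 1) *
    (\<Sum>i | i < length xs \<and> int (xs ! i) = int i + d. w ^ hits (d + int i + 1) (drop (Suc i) xs))"
proof (induction xs arbitrary: d)
  case (Cons x xs)
  let ?S = "{i. i < length xs \<and> int (xs ! i) = int i + (d + 1)}"
  have "(\<Sum>i | i < length (x # xs) \<and> int ((x # xs) ! i) = int i + d.
        w ^ hits (d + int i + 1) (drop (Suc i) (x # xs)))
     = (if int x = d then w ^ hits (d + 1) xs else 0)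
       + (\<Sum>i\<in>?S. w ^ hits (d + 1 + int i + 1) (drop (Suc i) xs))"
    unfolding hit_set_Cons by (auto simp: sum.reindex algebra_simps)
  then show ?case using Cons.IH[of "d + 1"] by (simp add: algebra_simps)
qed auto

abbreviation p132 :: "nat \<Rightarrow> nat \<Rightarrow> nat \<Rightarrow> bool" where "p132 x y z \<equiv> x < z \<and> z < y"
abbreviation p213 :: "nat \<Rightarrow> nat \<Rightarrow> nat \<Rightarrow> bool" where "p213 x y z \<equiv> y < x \<and> x < z"
abbreviation p321 :: "nat \<Rightarrow> nat \<Rightarrow> nat \<Rightarrow> bool" where "p321 x y z \<equiv> z < y \<and> y < x"
abbreviation p123 :: "nat \<Rightarrow> nat \<Rightarrow> nat \<Rightarrow> bool" where "p123 x y z \<equiv> x < y \<and> y < z"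

subsection \<open>Fixed points of 321-avoiding permutations\<close>

text \<open>The length of the initial decreasing run. In a 123-avoiding permutation of \<open>{..<n}\<close> the new
  maximum \<open>n\<close> can be inserted exactly at the positions up to the end of this run.\<close>

fun descent :: "nat list \<Rightarrow> nat" where
  "descent [] = 0"
| "descent (x # xs) = Suc (if xs \<noteq> [] \<and> hd xs < x then descent xs else 0)"

lemma le_descent_iff: "t \<le> descent xs \<longleftrightarrow> t \<le> length xs \<and> sorted_wrt (>) (take t xs)"
proof (induction xs arbitrary: t)
  case (Cons x xs)
  show ?case
  proof (cases t)
    case (Suc s)
    have "(\<forall>y\<in>set (take s xs). y < x) \<and> sorted_wrt (>) (take s xs) \<longleftrightarrow>
       (s = 0 \<or> xs = [] \<or> hd xs < x) \<and> sorted_wrt (>) (take s xs)"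
      by (cases s; cases xs) auto
    then show ?thesis using Suc Cons.IH[of s] by auto
  qed simp
qed simp

lemma descent_insert:
  assumes "\<forall>x\<in>set xs. x < n" "t \<le> descent xs"
  shows "descent (take t xs @ n # drop t xs) = (if t = 0 then Suc (descent xs) else t)"
  using assms
proof (induction xs arbitrary: t)
  case (Cons x xs)
  show ?case
  proof (cases t)
    case (Suc s)
    then show ?thesis using Cons.IH[of s] Cons.prems
      by (cases s; cases xs) (auto split: if_splits)
  qed (use Cons.prems in auto)
qed auto

lemma distinct_imp_sorted_wrt_neq: "distinct xs \<Longrightarrow> sorted_wrt (\<noteq>) xs"
  by (induction xs) auto

text \<open>The maximum \<open>n\<close> can only play the last letter of 123, so the entries before
  it must decrease and no other condition arises; deleting \<open>n\<close> is the inverse.\<close>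

lemma bij_betw_avoiding_123_insert:
  "bij_betw (\<lambda>(xs, t). take t xs @ n # drop t xs)
     (SIGMA xs:avoiding p123 n. {..descent xs}) (avoiding p123 (Suc n))"
  (is "bij_betw ?f ?A ?B")
proof (rule bij_betw_imageI)
  show "inj_on ?f ?A"
  proof (rule inj_onI, clarsimp)
    fix xs t ys s
    assume *: "xs \<in> avoiding p123 n" "ys \<in> avoiding p123 n" "t \<le> descent xs" "s \<le> descent ys"
      "take t xs @ n # drop t xs = take s ys @ n # drop s ys"
    then have "n \<notin> set (take t xs)" "n \<notin> set (drop t xs)"
      by (auto simp: avoiding_def dest: in_set_takeD in_set_dropD)
    with *(5) have eq: "take t xs = take s ys" "drop t xs = drop s ys"
      by (metis append_Cons_eq_iff)+
    then have "xs = ys" by (metis append_take_drop_id)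
    moreover have "length (take t xs) = length (take s ys)" using eq by simp
    ultimately show "xs = ys \<and> t = s" using *(3,4) le_descent_iff by auto
  qed
  have "?f x \<in> ?B" if mem: "x \<in> ?A" for x
  proof -
    obtain xs t where x: "x = (xs, t)" and xs: "xs \<in> avoiding p123 n" and t: "t \<le> descent xs"
      using mem by (cases x) auto
    define u v where "u = take t xs" and "v = drop t xs"
    have uv: "xs = u @ v" by (simp add: u_def v_def)
    have u: "sorted_wrt (>) u" using t le_descent_iff by (simp add: u_def)
    have lt: "\<forall>x\<in>set (u @ v). x < n" using xs by (auto simp: avoiding_def uv)
    have "avoids3 p123 (u @ v)" using xs by (simp add: avoiding_def uv)
    moreover have "sorted_wrt (\<lambda>x y. \<not> (x < y \<and> y < n)) u"
      using u by (rule sorted_wrt_mono_rel[rotated]) auto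
    moreover have "sorted_wrt (\<lambda>y z. \<not> (n < y \<and> y < z)) v"
    proof (rule sorted_wrt_if_all)
      fix y z assume "y \<in> set v"
      then have "y < n" using lt by simp
      then show "\<not> (n < y \<and> y < z)" by simp
    qed
    moreover have "y < n" if "y \<in> set u \<or> y \<in> set v" for y
      by (rule bspec[OF lt]) (use that in auto)
    ultimately have "avoids3 p123 (u @ n # v)"
      by (auto simp: avoids3_append less_imp_not_less elim!: sorted_wrt_mono_rel[rotated])
    moreover have "set (u @ n # v) = {..<Suc n}" "distinct (u @ n # v)"
      using xs by (auto simp: avoiding_def uv set_eq_iff less_Suc_eq)
    ultimately show ?thesis by (simp add: x avoiding_def u_def v_def)
  qed
  moreover have "xs \<in> ?f ` ?A" if "xs \<in> ?B" for xs
  proof -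
    have xs: "set xs = {..<Suc n}" "distinct xs" "avoids3 p123 xs"
      using that by (auto simp: avoiding_def)
    then have "n \<in> set xs" by simp
    then obtain u v where uv: "xs = u @ n # v" by (meson split_list)
    have un: "set (u @ v) = {..<n}" and d: "distinct (u @ v)"
      using xs unfolding uv by (auto simp: set_eq_iff less_Suc_eq)
    have "avoids3 p123 (u @ v)"
      using xs(3) unfolding uv avoids3_append
      by (auto elim!: sorted_wrt_mono_rel[rotated])
    \<comment> \<open>An ascent before \<open>n\<close> would be completed by \<open>n\<close> to a
      123.\<close>
    moreover have "sorted_wrt (>) u"
    proof -
      have *: "sorted_wrt (\<lambda>x y. \<forall>z\<in>set (n # v). \<not> p123 x y z) u" "sorted_wrt (\<noteq>) u"
        using xs(3) d distinct_imp_sorted_wrt_neq[of u] unfolding uv avoids3_append by simp_all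
      show ?thesis
        unfolding sorted_wrt_iff_nth_less
      proof (intro allI impI)
        fix i j assume ij: "i < j" "j < length u"
        then have "u ! j \<in> {..<n}" unfolding un[symmetric] by simp
        moreover have "\<not> p123 (u ! i) (u ! j) n" "u ! i \<noteq> u ! j"
          using sorted_wrt_nth_less[OF *(1) ij] sorted_wrt_nth_less[OF *(2) ij] by simp_all
        ultimately show "u ! j < u ! i" by simp
      qed
    qed
    ultimately have "u @ v \<in> avoiding p123 n" "length u \<le> descent (u @ v)"
      using un d by (simp_all add: avoiding_def le_descent_iff)
    then show ?thesis unfolding uv
      by (intro image_eqI[of _ _ "(u @ v, length u)"]) simp_all
  qed
  ultimately show "?f ` ?A = ?B" by blast
qed

text \<open>The children of a run of length \<open>s\<close> have runs
  \<open>s + 1, 1, ..., s\<close>. Unrolling the recursion of \<open>ballot\<close> down to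
  \<open>ballot 0 (Suc m) = 0\<close> yields the same sum.\<close>

lemma sum_ballot_children:
  "(\<Sum>t\<le>s. ballot (Suc (if t = 0 then Suc s else t)) m) = ballot (Suc s) (Suc m)"
proof (induction s)
  case (Suc s)
  have *: "(\<Sum>t\<le>s. ballot (Suc (if t = 0 then r else t)) m)
      = ballot (Suc r) m + (\<Sum>t<s. ballot (Suc (Suc t)) m)" for s r
    by (cases s) (simp_all add: sum.atMost_Suc_shift lessThan_Suc_atMost del: sum.atMost_Suc)
  from Suc.IH show ?case unfolding * by simp
qed simp

text \<open>A permutation with initial run of length \<open>s\<close> has \<open>ballot (s + 1) m\<close> descendants after \<open>m\<close>
  insertions.\<close>

lemma sum_ballot_descent:
  "(\<Sum>xs\<in>avoiding p123 n. ballot (Suc (descent xs)) m) = catalan (n + m)"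
proof (induction n arbitrary: m)
  case (Suc n)
  have "(\<Sum>xs\<in>avoiding p123 (Suc n). ballot (Suc (descent xs)) m)
     = (\<Sum>(xs, t)\<in>(SIGMA xs:avoiding p123 n. {..descent xs}).
           ballot (Suc (descent (take t xs @ n # drop t xs))) m)"
    by (subst sum.reindex_bij_betw[OF bij_betw_avoiding_123_insert, symmetric])
       (simp add: case_prod_unfold)
  also have "\<dots> = (\<Sum>xs\<in>avoiding p123 n. \<Sum>t\<le>descent xs.
           ballot (Suc (descent (take t xs @ n # drop t xs))) m)"
    by (simp add: sum.Sigma)
  also have "\<dots> = (\<Sum>xs\<in>avoiding p123 n. \<Sum>t\<le>descent xs.
           ballot (Suc (if t = 0 then Suc (descent xs) else t)) m)"
    by (intro sum.cong refl) (auto simp: descent_insert avoiding_def)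
  also have "\<dots> = catalan (Suc n + m)"
    unfolding sum_ballot_children Suc.IH by simp
  finally show ?case .
qed simp

lemma bij_betw_rev_avoiding:
  "bij_betw rev (avoiding P n) (avoiding (\<lambda>x y z. P z y x) n)"
  by (rule bij_betw_byWitness[where f' = rev])
     (simp_all add: avoiding_def avoids3_rev image_subset_iff)

text \<open>At \<open>m = 0\<close> every weight in \<open>sum_ballot_descent\<close> is 1, and
  reversal maps 123 to 321.\<close>

lemma card_avoiding_321: "card (avoiding p321 n) = catalan n"
proof -
  have "card (avoiding p123 n) = catalan n"
    using sum_ballot_descent[of 0 n] by simp
  then show ?thesis
    using bij_betw_same_card[OF bij_betw_rev_avoiding[of p123 n]] by simp
qed

text \<open>A fixed point of a 321-avoiding permutation separates smaller positions and values from
  larger ones, so the two sides are independent 321-avoiders.\<close>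

lemma bij_betw_avoiding_321_fixed_point:
  assumes "i < n"
  shows "bij_betw (\<lambda>(L, R). L @ i # map (\<lambda>x. x + Suc i) R)
     (avoiding p321 i \<times> avoiding p321 (n - Suc i)) {xs \<in> avoiding p321 n. xs ! i = i}"
  (is "bij_betw ?f ?A ?B")
proof (rule bij_betw_imageI)
  show "inj_on ?f ?A"
    by (rule inj_onI, clarsimp) (frule (1) length_avoiding[THEN trans[OF _ length_avoiding[symmetric]]],
      simp add: inj_map_eq_map inj_def)
  have "?f x \<in> ?B" if mem: "x \<in> ?A" for x
  proof -
    obtain L R where x: "x = (L, R)" and L: "L \<in> avoiding p321 i"
      and R: "R \<in> avoiding p321 (n - Suc i)"
      using mem by (cases x) auto
    let ?R = "map (\<lambda>x. x + Suc i) R"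
    have sR: "set ?R = {Suc i..<n}"
      using R assms set_map_add[of R "n - Suc i" "Suc i"] by (simp add: avoiding_def)
    have sL: "set L = {..<i}" using L by (auto simp: avoiding_def)
    have "avoids3 p321 L" "avoids3 p321 ?R"
      using L R by (auto simp: avoiding_def avoids3_map)
    then have "avoids3 p321 (L @ i # ?R)"
      unfolding avoids3_append avoids3.simps using sL sR
      by (auto intro!: sorted_wrt_if_all simp del: set_map)
    moreover have "set (L @ i # ?R) = {..<n}"
      using assms unfolding set_append list.set sL sR by auto
    moreover have "distinct L" "distinct ?R"
      using L R by (simp_all add: avoiding_def distinct_map inj_on_def)
    then have "distinct (L @ i # ?R)"
      unfolding distinct_append distinct.simps set_append list.set sL sR by auto
    moreover have "length L = i" using L by (rule length_avoiding)
    ultimately show ?thesis by (auto simp: avoiding_def x nth_append)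
  qed
  moreover have "xs \<in> ?f ` ?A" if "xs \<in> ?B" for xs
  proof -
    have xs: "set xs = {..<n}" "distinct xs" "avoids3 p321 xs" "xs ! i = i" and len: "length xs = n"
      using that length_avoiding by (auto simp: avoiding_def)
    define u v where "u = take i xs" and "v = drop (Suc i) xs"
    have uv: "xs = u @ i # v" using id_take_nth_drop[of i xs] assms xs(4) by (simp add: u_def v_def len)
    have un: "set u \<union> set v = {..<n} - {i}" and dj: "set u \<inter> set v = {}"
      using xs unfolding uv by (auto simp: set_eq_iff)
    have card: "card (set u) = i" "card (set v) = n - Suc i"
      using xs(2) assms by (auto simp: uv distinct_card) (auto simp: u_def v_def len)
    \<comment> \<open>Pigeonhole: if \<open>b < i\<close> stood right of \<open>i\<close>, an entry
      above \<open>i\<close> on the left would form 321, so the \<open>i\<close> entries on the left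
      would lie in \<open>{..<i} - {b}\<close>.\<close>
    have no: "\<not> b < i" if "b \<in> set v" for b
    proof
      assume "b < i"
      have "a < i" if "a \<in> set u" for a
      proof -
        have "\<not> (b < i \<and> i < a)"
          using xs(3) \<open>b \<in> set v\<close> that unfolding uv avoids3_append by auto
        moreover have "a \<noteq> i" using un(1) that by auto
        ultimately show ?thesis using \<open>b < i\<close> by simp
      qed
      then have "set u \<subseteq> {..<i} - {b}" using dj that by auto
      then have "card (set u) \<le> card ({..<i} - {b})" by (intro card_mono) auto
      then show False using \<open>b < i\<close> by (simp add: card)
    qed
    have "set v \<subseteq> {Suc i..<n}"
    proof
      fix b assume "b \<in> set v"
      then have "b \<in> {..<n} - {i}" "\<not> b < i" using no un by auto
      then show "b \<in> {Suc i..<n}" by auto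
    qed
    then have sv: "set v = {Suc i..<n}"
      by (intro card_subset_eq) (auto simp: card)
    have "set u = {..<n} - {i} - set v" using un dj by blast
    also have "\<dots> = {..<i}" unfolding sv using assms by auto
    finally have su: "set u = {..<i}" .
    have "avoids3 p321 u" "avoids3 p321 v" using xs(3) unfolding uv avoids3_append by auto
    moreover have "set v = {Suc i..<Suc i + (n - Suc i)}" "distinct u" "distinct v"
      using sv assms xs(2) by (simp_all add: uv)
    ultimately obtain R where R: "R \<in> avoiding p321 (n - Suc i)" "v = map (\<lambda>x. x + Suc i) R"
      using avoiding_shift[of p321 "Suc i" v "n - Suc i"] by auto
    have "u \<in> avoiding p321 i"
      using \<open>avoids3 p321 u\<close> su \<open>distinct u\<close> by (simp add: avoiding_def)
    with R show ?thesis unfolding uv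
      by (auto intro!: image_eqI[of _ _ "(u, R)"])
  qed
  ultimately show "?f ` ?A = ?B" by blast
qed

text \<open>Expanding over the first chosen fixed point gives \<open>ballot_poly_rec\<close>:
  nothing is chosen to its left, hence a Catalan factor, and the right is an induction
  hypothesis.\<close>

lemma sum_hits_321:
  fixes w :: "'a::comm_ring_1"
  shows "(\<Sum>xs\<in>avoiding p321 n. w ^ hits 0 xs) = ballot_poly (w - 1) n"
proof (induction n rule: less_induct)
  case (less n)
  \<comment> \<open>No entry crosses a fixed point \<open>i\<close> of a 321-avoiding permutation, so it splits at \<open>i\<close>.\<close>
  have pos: "(\<Sum>xs | xs \<in> avoiding p321 n \<and> xs ! i = i. w ^ hits (int i + 1) (drop (Suc i) xs))
      = of_nat (catalan i) * ballot_poly (w - 1) (n - Suc i)" if "i < n" for i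
  proof -
    have "(\<Sum>xs | xs \<in> avoiding p321 n \<and> xs ! i = i. w ^ hits (int i + 1) (drop (Suc i) xs))
      = (\<Sum>(L, R)\<in>avoiding p321 i \<times> avoiding p321 (n - Suc i). w ^ hits 0 R)"
      by (subst sum.reindex_bij_betw[OF bij_betw_avoiding_321_fixed_point[OF that], symmetric])
         (rule sum.cong, auto simp: length_avoiding hits_shift[of _ "Suc i", simplified])
    then show ?thesis
      using that by (simp add: sum.cartesian_product[symmetric] card_avoiding_321 less.IH)
  qed
  have "(\<Sum>xs\<in>avoiding p321 n. w ^ hits 0 xs)
      = of_nat (catalan n) + (w - 1) * (\<Sum>xs\<in>avoiding p321 n. \<Sum>i | i < n \<and> xs ! i = i.
          w ^ hits (int i + 1) (drop (Suc i) xs))"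
    by (subst hits_power_expand)
       (simp add: sum.distrib card_avoiding_321 length_avoiding sum_distrib_left cong: sum.cong)
  also have "(\<Sum>xs\<in>avoiding p321 n. \<Sum>i | i < n \<and> xs ! i = i. w ^ hits (int i + 1) (drop (Suc i) xs))
     = (\<Sum>i<n. \<Sum>xs | xs \<in> avoiding p321 n \<and> xs ! i = i. w ^ hits (int i + 1) (drop (Suc i) xs))"
    using sum.swap_restrict[of "avoiding p321 n" "{..<n}"
        "\<lambda>xs i. w ^ hits (int i + 1) (drop (Suc i) xs)" "\<lambda>xs i. xs ! i = i"] by simp
  also have "\<dots> = (\<Sum>i<n. of_nat (catalan i) * ballot_poly (w - 1) (n - Suc i))"
    by (intro sum.cong refl pos) simp
  finally show ?case unfolding ballot_poly_rec[of _ n] .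
qed

subsection \<open>Fixed points of 132- and 213-avoiding permutations\<close>

text \<open>Decomposition at the maximum: entries \<open>a\<close> before and \<open>b\<close> after
  \<open>n\<close> with \<open>a < b\<close> would form 132, so the front block lies entirely above
  the back block, of length \<open>j\<close>.\<close>

lemma bij_betw_avoiding_132:
  "bij_betw (\<lambda>(j, L, R). map (\<lambda>x. x + j) L @ n # R)
     (SIGMA j:{..n}. avoiding p132 (n - j) \<times> avoiding p132 j) (avoiding p132 (Suc n))"
  (is "bij_betw ?f ?A ?B")
proof (rule bij_betw_imageI)
  show "inj_on ?f ?A"
  proof (rule inj_onI, clarsimp)
    fix j L R j' L' R'
    assume *: "j \<le> n" "j' \<le> n" "L \<in> avoiding p132 (n - j)" "L' \<in> avoiding p132 (n - j')"
       "R \<in> avoiding p132 j" "R' \<in> avoiding p132 j'"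
       "map (\<lambda>x. x + j) L @ n # R = map (\<lambda>x. x + j') L' @ n # R'"
    have "n \<notin> set (map (\<lambda>x. x + j) L)" "n \<notin> set R"
      using * by (auto simp: avoiding_def)
    with * have "map (\<lambda>x. x + j) L = map (\<lambda>x. x + j') L' \<and> R = R'"
      using append_Cons_eq_iff[of n "map (\<lambda>x. x + j) L" R "map (\<lambda>x. x + j') L'" R'] by simp
    moreover have "length R = j" "length R' = j'" using * by (simp_all add: length_avoiding)
    then have "j = j'" using calculation by simp
    ultimately show "j = j' \<and> L = L' \<and> R = R'" by (simp add: inj_map_eq_map)
  qed
  have "?f x \<in> ?B" if mem: "x \<in> ?A" for x
  proof -
    obtain j L R where x: "x = (j, L, R)" "j \<le> n" and L: "L \<in> avoiding p132 (n - j)"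
      and R: "R \<in> avoiding p132 j"
      using mem by (cases x) auto
    have sL: "set (map (\<lambda>x. x + j) L) = {j..<n}"
      using L x set_map_add[of L "n - j" j] by (simp add: avoiding_def)
    have sR: "set R = {..<j}" using R by (auto simp: avoiding_def)
    have "avoids3 p132 (map (\<lambda>x. x + j) L)" "avoids3 p132 R"
      using L R by (auto simp: avoiding_def avoids3_map)
    then have "avoids3 p132 (map (\<lambda>x. x + j) L @ n # R)"
      unfolding avoids3_append using sL sR x(2)
      by (auto intro!: sorted_wrt_if_all simp del: set_map)
    moreover have "set (map (\<lambda>x. x + j) L @ n # R) = {..<Suc n}"
      using x(2) unfolding set_append list.set sL sR by auto
    moreover have "distinct (map (\<lambda>x. x + j) L)" "distinct R"
      using L R by (simp_all add: avoiding_def distinct_map inj_on_def)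
    then have "distinct (map (\<lambda>x. x + j) L @ n # R)"
      using x(2) unfolding distinct_append distinct.simps set_append list.set sL sR by auto
    ultimately show ?thesis by (simp add: avoiding_def x)
  qed
  moreover have "xs \<in> ?f ` ?A" if "xs \<in> ?B" for xs
  proof -
    have xs: "set xs = {..<Suc n}" "distinct xs" "avoids3 p132 xs"
      using that by (auto simp: avoiding_def)
    then have "n \<in> set xs" by simp
    then obtain u v where uv: "xs = u @ n # v" by (meson split_list)
    have un: "set u \<union> set v = {..<n}" "n \<notin> set u" "n \<notin> set v" and dj: "set u \<inter> set v = {}"
      using xs unfolding uv by (auto simp: set_eq_iff less_Suc_eq)
    have less: "b < a" if "a \<in> set u" "b \<in> set v" for a b
    proof -
      have "\<not> (a < b \<and> b < n)" using xs(3) that unfolding uv avoids3_append by auto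
      moreover have "b < n" "a \<noteq> b" using un dj that by auto
      ultimately show ?thesis by simp
    qed
    define j where "j = length v"
    have "card (set v) = j" using xs(2) by (simp add: uv j_def distinct_card)
    moreover have "set v = {..<card (set v)}"
    proof (rule down_closed_eq_lessThan)
      fix x y assume xy: "y \<in> set v" "x < y"
      then have "y \<in> {..<n}" using un(1) by blast
      with xy have "x \<in> {..<n}" by simp
      then have "x \<in> set u \<union> set v" using un(1) by blast
      moreover have "x \<notin> set u" using less[of x y] xy by auto
      ultimately show "x \<in> set v" by blast
    qed simp
    ultimately have sv: "set v = {..<j}" by simp
    have j: "j \<le> n" using un sv by (metis Un_upper2 card_lessThan card_mono finite_lessThan)
    have su: "set u = {j..<j + (n - j)}"
    proof -
      have "set u = {..<n} - {..<j}" using un(1) dj unfolding sv by blast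
      with j show ?thesis by auto
    qed
    have "avoids3 p132 u" "avoids3 p132 v" using xs(3) unfolding uv avoids3_append by auto
    moreover have "distinct u" "distinct v" using xs(2) by (simp_all add: uv)
    ultimately obtain L where L: "L \<in> avoiding p132 (n - j)" "u = map (\<lambda>x. x + j) L"
      using avoiding_shift[of p132 j u "n - j"] su by auto
    have "v \<in> avoiding p132 j"
      using \<open>avoids3 p132 v\<close> sv \<open>distinct v\<close> by (simp add: avoiding_def)
    with L j show ?thesis unfolding uv
      by (auto intro!: image_eqI[of _ _ "(j, L, v)"])
  qed
  ultimately show "?f ` ?A = ?B" by blast
qed

lemma sum_hits_132_Suc:
  fixes w :: "'a::comm_ring_1"
  shows "(\<Sum>xs\<in>avoiding p132 (Suc n). w ^ hits d xs) =
    (\<Sum>j\<le>n. (\<Sum>xs\<in>avoiding p132 (n - j). w ^ hits (d - int j) xs) * w ^ of_bool (int j = d)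
        * (\<Sum>xs\<in>avoiding p132 j. w ^ hits (d + int n - int j + 1) xs))"
proof -
  \<comment> \<open>The front block has its values raised by \<open>j\<close>, the maximum stands at
    position \<open>n - j\<close>, and the back block starts at position \<open>n - j + 1\<close>;
    this fixes the three offsets.\<close>
  have h: "hits d (map (\<lambda>x. x + j) L @ n # R)
      = hits (d - int j) L + of_bool (int j = d) + hits (d + int n - int j + 1) R"
    if "j \<le> n" "L \<in> avoiding p132 (n - j)" for j L R
    using that by (auto simp: hits_append hits_shift length_avoiding of_nat_diff algebra_simps)
  have "(\<Sum>xs\<in>avoiding p132 (Suc n). w ^ hits d xs)
     = (\<Sum>(j, L, R)\<in>(SIGMA j:{..n}. avoiding p132 (n - j) \<times> avoiding p132 j).
           w ^ hits d (map (\<lambda>x. x + j) L @ n # R))"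
    by (subst sum.reindex_bij_betw[OF bij_betw_avoiding_132, symmetric])
       (simp add: case_prod_unfold)
  also have "\<dots> = (\<Sum>j\<le>n. \<Sum>L\<in>avoiding p132 (n - j). \<Sum>R\<in>avoiding p132 j.
           w ^ hits d (map (\<lambda>x. x + j) L @ n # R))"
    by (simp add: sum.Sigma)
  also have "\<dots> = (\<Sum>j\<le>n. \<Sum>L\<in>avoiding p132 (n - j). \<Sum>R\<in>avoiding p132 j.
           w ^ hits (d - int j) L * w ^ of_bool (int j = d) * w ^ hits (d + int n - int j + 1) R)"
    by (intro sum.cong refl) (simp add: h power_add)
  also have "\<dots> = (\<Sum>j\<le>n. (\<Sum>xs\<in>avoiding p132 (n - j). w ^ hits (d - int j) xs) * w ^ of_bool (int j = d)
        * (\<Sum>xs\<in>avoiding p132 j. w ^ hits (d + int n - int j + 1) xs))"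
    by (simp only: sum_distrib_left[symmetric] sum_distrib_right[symmetric])
  finally show ?thesis .
qed

text \<open>The contribution of nonempty sets of chosen \<open>d\<close>-hits: the hits on one diagonal correspond to
  nested tunnels of a Dyck path with a common midpoint, and the outermost one cuts a Dyck path of
  semilength \<open>l \<ge> |d|\<close>.\<close>

definition excess :: "'a::comm_ring_1 \<Rightarrow> nat \<Rightarrow> int \<Rightarrow> 'a" where
  "excess p n d = p * (\<Sum>l<n. of_bool (\<bar>d\<bar> \<le> int l) * (of_nat (catalan l) * ballot_poly p (n - Suc l)))"

lemma excess_eq_0: "int n \<le> \<bar>d\<bar> \<Longrightarrow> excess p n d = 0"
  unfolding excess_def by (subst sum.neutral) auto

lemma excess_0: "excess p n 0 = ballot_poly p n - of_nat (catalan n)"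
  by (subst ballot_poly_rec) (simp add: excess_def)

lemma sum_triangle_diagonal:
  fixes f :: "nat \<Rightarrow> nat \<Rightarrow> 'a::comm_monoid_add"
  shows "(\<Sum>j\<le>n. \<Sum>l<n - j. f j l) = (\<Sum>m<n. \<Sum>j\<le>m. f j (m - j))"
  by (simp add: sum.Sigma)
     (rule sum.reindex_bij_witness[of _ "\<lambda>(m, j). (j, m - j)" "\<lambda>(j, l). (j + l, j)"], auto)

lemma sum_reflect_atMost:
  fixes f :: "nat \<Rightarrow> 'a::comm_monoid_add"
  shows "(\<Sum>j\<le>n. f (n - j)) = (\<Sum>j\<le>n. f j)"
  by (rule sum.reindex_bij_witness[of _ "\<lambda>j. n - j" "\<lambda>j. n - j"]) auto

lemma catalan_Suc: "(\<Sum>j\<le>m. catalan j * catalan (m - j)) = catalan (Suc m)"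
  using ballot_convolution[of 1 1 m] by (simp add: numeral_2_eq_2)

text \<open>If the chosen hits lie in one block, the other contributes a Catalan number. Collected
  by \<open>m = j + l\<close>, front and back contributions together form a full Catalan
  convolution.\<close>

lemma catalan_excess_sum:
  "(\<Sum>j\<le>n. of_nat (catalan j) * excess p (n - j) (d - int j))
    + (\<Sum>j\<le>n. of_nat (catalan (n - j)) * excess p j (d + int n - int j + 1))
   = p * (\<Sum>m<n. of_bool (if 0 \<le> d then d \<le> int m else - d \<le> int m + 1) *
                 (of_nat (catalan (Suc m)) * ballot_poly p (n - Suc m)))"
proof -
  let ?c = "\<lambda>n. of_nat (catalan n) :: 'a"
  have 1: "(\<Sum>j\<le>n. ?c j * excess p (n - j) (g j)) =
     p * (\<Sum>m<n. (\<Sum>j\<le>m. of_bool (\<bar>g j\<bar> \<le> int (m - j)) * (?c j * ?c (m - j))) * ballot_poly p (n - Suc m))" for g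
  proof -
    have "(\<Sum>j\<le>n. ?c j * excess p (n - j) (g j)) =
      p * (\<Sum>j\<le>n. \<Sum>l<n - j. of_bool (\<bar>g j\<bar> \<le> int l) * (?c j * ?c l) * ballot_poly p (n - Suc (j + l)))"
      by (simp add: excess_def sum_distrib_left ac_simps)
    also have "\<dots> = p * (\<Sum>m<n. \<Sum>j\<le>m. of_bool (\<bar>g j\<bar> \<le> int (m - j)) * (?c j * ?c (m - j)) * ballot_poly p (n - Suc m))"
      by (subst sum_triangle_diagonal) simp
    finally show ?thesis by (simp only: sum_distrib_right)
  qed
  \<comment> \<open>Reflecting \<open>j\<close> makes the second sum an instance of fact
    \<open>1\<close>; reflecting back inside each \<open>m\<close> lets the two indicators be added
    for the same \<open>j\<close>.\<close>
  have "(\<Sum>j\<le>n. ?c (n - j) * excess p j (d + int n - int j + 1))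
     = (\<Sum>j\<le>n. ?c j * excess p (n - j) (d + int j + 1))"
    by (subst sum_reflect_atMost[symmetric]) (simp add: of_nat_diff)
  also have "\<dots> = p * (\<Sum>m<n. (\<Sum>j\<le>m. of_bool (\<bar>d + int j + 1\<bar> \<le> int (m - j)) * (?c j * ?c (m - j)))
       * ballot_poly p (n - Suc m))"
    by (rule 1)
  also have "\<dots> = p * (\<Sum>m<n. (\<Sum>j\<le>m. of_bool (\<bar>d + int m - int j + 1\<bar> \<le> int j) * (?c j * ?c (m - j)))
       * ballot_poly p (n - Suc m))"
  proof -
    have "(\<Sum>j\<le>m. of_bool (\<bar>d + int j + 1\<bar> \<le> int (m - j)) * (?c j * ?c (m - j)))
      = (\<Sum>j\<le>m. of_bool (\<bar>d + int m - int j + 1\<bar> \<le> int j) * (?c j * ?c (m - j)))" for m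
      by (rule trans[OF sum_reflect_atMost[symmetric]])
         (intro sum.cong refl, auto simp: of_nat_diff mult.commute algebra_simps)
    then show ?thesis by simp
  qed
  finally have 2: "(\<Sum>j\<le>n. ?c (n - j) * excess p j (d + int n - int j + 1)) = \<dots>" .
  have 3: "(\<Sum>j\<le>m. of_bool (\<bar>d - int j\<bar> \<le> int (m - j)) * (?c j * ?c (m - j)))
      + (\<Sum>j\<le>m. of_bool (\<bar>d + int m - int j + 1\<bar> \<le> int j) * (?c j * ?c (m - j)))
     = of_bool (if 0 \<le> d then d \<le> int m else - d \<le> int m + 1) * ?c (Suc m)" (is "?l = ?b * _") for m
  proof -
    have "?l = (\<Sum>j\<le>m. ?b * (?c j * ?c (m - j)))"
      unfolding sum.distrib[symmetric]
    proof (intro sum.cong refl)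
      fix j assume "j \<in> {..m}"
      \<comment> \<open>For \<open>j \<le> m\<close> the first indicator means
        \<open>2 * j \<le> m + d\<close> and \<open>d \<le> m\<close>, the second
        \<open>2 * j > m + d\<close> and \<open>- d \<le> m + 1\<close>; at most one holds, and one
        does exactly when \<open>?b\<close> is 1.\<close>
      then have "(of_bool (\<bar>d - int j\<bar> \<le> int (m - j)) :: 'a)
          + of_bool (\<bar>d + int m - int j + 1\<bar> \<le> int j) = ?b"
        by (auto simp: of_nat_diff of_bool_def)
      then show "of_bool (\<bar>d - int j\<bar> \<le> int (m - j)) * (?c j * ?c (m - j))
        + of_bool (\<bar>d + int m - int j + 1\<bar> \<le> int j) * (?c j * ?c (m - j)) = ?b * (?c j * ?c (m - j))"
        by (simp only: distrib_right[symmetric])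
    qed
    also have "\<dots> = ?b * of_nat (\<Sum>j\<le>m. catalan j * catalan (m - j))"
      by (simp only: sum_distrib_left of_nat_sum of_nat_mult)
    finally show ?thesis unfolding catalan_Suc .
  qed
  have 4: "(\<Sum>j\<le>m. of_bool (\<bar>d - int j\<bar> \<le> int (m - j)) * (?c j * ?c (m - j))) * y
      + (\<Sum>j\<le>m. of_bool (\<bar>d + int m - int j + 1\<bar> \<le> int j) * (?c j * ?c (m - j))) * y
     = of_bool (if 0 \<le> d then d \<le> int m else - d \<le> int m + 1) * (?c (Suc m) * y)" for m y
    unfolding distrib_right[symmetric] 3 mult.assoc ..
  show ?thesis
    unfolding 1 2 distrib_left[symmetric] sum.distrib[symmetric] 4 ..
qed

text \<open>Shaped to match \<open>sum_hits_132_Suc\<close>: the term \<open>l = d\<close> accounts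
  for the maximum being a hit, and the later terms, shifted by one, are the value of
  \<open>catalan_excess_sum\<close>. For negative \<open>d\<close> the term at \<open>l = 0\<close>
  vanishes.\<close>

lemma excess_Suc:
  "excess p (Suc n) d = (\<Sum>j\<le>n. if int j = d then p * (ballot_poly p (n - j) * of_nat (catalan j)) else 0)
     + p * (\<Sum>m<n. of_bool (if 0 \<le> d then d \<le> int m else - d \<le> int m + 1) *
                 (of_nat (catalan (Suc m)) * ballot_poly p (n - Suc m)))"
proof (cases "d \<ge> 0")
  case True
  define f where "f l = of_nat (catalan l) * ballot_poly p (n - l)" for l
  have "excess p (Suc n) d = p * (\<Sum>l<Suc n. of_bool (int l = d) * f l + of_bool (d < int l) * f l)"
    using True unfolding excess_def f_def
    by (intro arg_cong2[where f = "(*)"] sum.cong refl) auto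
  also have "\<dots> = p * (\<Sum>l\<le>n. of_bool (int l = d) * f l) + p * (\<Sum>l<Suc n. of_bool (d < int l) * f l)"
    by (simp only: sum.distrib distrib_left lessThan_Suc_atMost)
  also have "(\<Sum>l<Suc n. of_bool (d < int l) * f l) = (\<Sum>m<n. of_bool (d \<le> int m) * f (Suc m))"
    using True by (subst sum.lessThan_Suc_shift) (auto intro!: sum.cong)
  also have "p * (\<Sum>l\<le>n. of_bool (int l = d) * f l)
     = (\<Sum>j\<le>n. if int j = d then p * (ballot_poly p (n - j) * of_nat (catalan j)) else 0)"
    unfolding sum_distrib_left by (intro sum.cong refl) (simp add: f_def mult.commute)
  finally show ?thesis using True by (simp add: f_def)
next
  case False
  then have "(\<Sum>j\<le>n. if int j = d then p * (ballot_poly p (n - j) * of_nat (catalan j)) else 0) = 0"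
    by (intro sum.neutral) auto
  moreover have "excess p (Suc n) d = p * (\<Sum>m<n. of_bool (- d \<le> int m + 1) *
                 (of_nat (catalan (Suc m)) * ballot_poly p (n - Suc m)))"
    using False unfolding excess_def
    by (subst sum.lessThan_Suc_shift) (auto intro!: sum.cong arg_cong2[where f = "(*)"])
  ultimately show ?thesis using False by simp
qed

text \<open>The induction runs over every offset \<open>d\<close>, even though fixed points have
  \<open>d = 0\<close>, because the two blocks see other diagonals.\<close>

lemma sum_hits_132:
  fixes w :: "'a::comm_ring_1"
  shows "(\<Sum>xs\<in>avoiding p132 n. w ^ hits d xs) = of_nat (catalan n) + excess (w - 1) n d"
proof (induction n arbitrary: d rule: less_induct)
  case (less n)
  show ?case
  proof (cases n)
    case 0
    then show ?thesis by (simp add: excess_def)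
  next
    case (Suc N)
    let ?p = "w - 1" and ?c = "\<lambda>n. of_nat (catalan n) :: 'a"
    \<comment> \<open>At most one of the two pieces can contain hits.\<close>
    have summand: "(?c (N - j) + excess ?p (N - j) (d - int j)) * w ^ of_bool (int j = d)
         * (?c j + excess ?p j (d + int N - int j + 1))
       = ?c j * ?c (N - j)
         + (?c j * excess ?p (N - j) (d - int j) + ?c (N - j) * excess ?p j (d + int N - int j + 1))
         + (if int j = d then ?p * (ballot_poly ?p (N - j) * ?c j) else 0)" if "j \<le> N" for j
    proof (cases "int j = d")
      case True
      \<comment> \<open>The back block sees offset \<open>N + 1\<close>, too large for any hit, and
        the front block sees offset 0, where \<open>excess_0\<close> applies.\<close>
      have "excess ?p j (d + int N - int j + 1) = 0"
        using True that by (intro excess_eq_0) auto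
      then show ?thesis using True by (simp add: excess_0 algebra_simps)
    next
      case False
      have "excess ?p (N - j) (d - int j) = 0 \<or> excess ?p j (d + int N - int j + 1) = 0"
      proof (cases "int (N - j) \<le> \<bar>d - int j\<bar>")
        case False
        then have "int j \<le> \<bar>d + int N - int j + 1\<bar>" using that by (simp add: of_nat_diff)
        then show ?thesis using excess_eq_0 by blast
      qed (auto intro: excess_eq_0)
      then show ?thesis using False by (auto simp: algebra_simps)
    qed
    have "(\<Sum>xs\<in>avoiding p132 n. w ^ hits d xs)
       = (\<Sum>j\<le>N. (?c (N - j) + excess ?p (N - j) (d - int j)) * w ^ of_bool (int j = d)
         * (?c j + excess ?p j (d + int N - int j + 1)))"
      unfolding Suc sum_hits_132_Suc
      by (intro sum.cong refl arg_cong2[where f = "(*)"] less.IH) (auto simp: Suc)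
    also have "\<dots> = (\<Sum>j\<le>N. ?c j * ?c (N - j)
         + (?c j * excess ?p (N - j) (d - int j) + ?c (N - j) * excess ?p j (d + int N - int j + 1))
         + (if int j = d then ?p * (ballot_poly ?p (N - j) * ?c j) else 0))"
      by (intro sum.cong refl summand) simp
    also have "\<dots> = of_nat (\<Sum>j\<le>N. catalan j * catalan (N - j)) + excess ?p (Suc N) d"
      unfolding sum.distrib catalan_excess_sum excess_Suc of_nat_sum of_nat_mult by (simp only: ac_simps)
    finally show ?thesis unfolding catalan_Suc Suc .
  qed
qed

lemma sum_hits_0_132:
  fixes w :: "'a::comm_ring_1"
  shows "(\<Sum>xs\<in>avoiding p132 n. w ^ hits 0 xs) = ballot_poly (w - 1) n"
  unfolding sum_hits_132 excess_0 by simp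

section \<open>The reverse-complement symmetry between 132 and 213\<close>

definition rev_complement :: "nat \<Rightarrow> nat list \<Rightarrow> nat list" where
  "rev_complement n xs = rev (map (\<lambda>x. n - Suc x) xs)"

text \<open>On \<open>{..<n}\<close> this is conjugation by the involution sending \<open>i\<close>
  to \<open>n - Suc i\<close>, so it is an involution itself and carries fixed points to fixed
  points.\<close>

lemma rev_complement_in_avoiding:
  assumes xs: "xs \<in> avoiding P n"
    and PQ: "\<And>x y z. x < n \<Longrightarrow> y < n \<Longrightarrow> z < n \<Longrightarrow> P x y z \<longleftrightarrow> Q (n - Suc z) (n - Suc y) (n - Suc x)"
  shows "rev_complement n xs \<in> avoiding Q n" "rev_complement n (rev_complement n xs) = xs"
    "hits 0 (rev_complement n xs) = hits 0 xs"
proof -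
  have set: "set xs = {..<n}" and d: "distinct xs" and av: "avoids3 P xs"
    using xs by (auto simp: avoiding_def)
  have len: "length xs = n" using xs by (rule length_avoiding)
  have "(\<lambda>x. n - Suc x) ` {..<n} = {..<n}"
  proof (intro equalityI subsetI)
    fix x assume "x \<in> {..<n}"
    then show "x \<in> (\<lambda>x. n - Suc x) ` {..<n}" by (intro image_eqI[of _ _ "n - Suc x"]) auto
  qed auto
  moreover have "inj_on (\<lambda>x. n - Suc x) {..<n}" by (auto simp: inj_on_def)
  moreover have "avoids3 (\<lambda>x y z. Q (n - Suc z) (n - Suc y) (n - Suc x)) xs"
    using av by (subst avoids3_cong[where Q = P]) (use set PQ in auto)
  ultimately show "rev_complement n xs \<in> avoiding Q n"
    using set d by (simp add: avoiding_def rev_complement_def distinct_map avoids3_rev avoids3_map)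
  have "map (\<lambda>x. n - Suc (n - Suc x)) xs = map id xs"
    by (rule map_cong) (use set in auto)
  then show "rev_complement n (rev_complement n xs) = xs"
    by (simp add: rev_complement_def rev_map o_def)
  have nth: "rev_complement n xs ! i = n - Suc (xs ! (n - Suc i))" if "i < n" for i
    using that by (simp add: rev_complement_def rev_map[symmetric] rev_nth len)
  have lt: "xs ! i < n" if "i < n" for i
    using nth_mem[of i xs] that unfolding set len by simp
  have "bij_betw (\<lambda>i. n - Suc i) {i. i < n \<and> rev_complement n xs ! i = i} {i. i < n \<and> xs ! i = i}"
  proof (rule bij_betw_byWitness[where f' = "\<lambda>i. n - Suc i"])
    show "(\<lambda>i. n - Suc i) ` {i. i < n \<and> rev_complement n xs ! i = i} \<subseteq> {i. i < n \<and> xs ! i = i}"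
    proof clarsimp
      fix i assume i: "i < n" "rev_complement n xs ! i = i"
      then show "xs ! (n - Suc i) = n - Suc i" using nth[of i] lt[of "n - Suc i"] by simp
    qed
    show "(\<lambda>i. n - Suc i) ` {i. i < n \<and> xs ! i = i} \<subseteq> {i. i < n \<and> rev_complement n xs ! i = i}"
      by (auto simp: nth)
  qed auto
  then have "card {i. i < n \<and> rev_complement n xs ! i = i} = card {i. i < n \<and> xs ! i = i}"
    by (rule bij_betw_same_card)
  moreover have "length (rev_complement n xs) = n" by (simp add: rev_complement_def len)
  ultimately show "hits 0 (rev_complement n xs) = hits 0 xs"
    by (simp add: hits_conv_card len)
qed

lemma sum_hits_213:
  fixes w :: "'a::comm_ring_1"
  shows "(\<Sum>xs\<in>avoiding p213 n. w ^ hits 0 xs) = ballot_poly (w - 1) n"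
proof -
  have 1: "p213 x y z \<longleftrightarrow> p132 (n - Suc z) (n - Suc y) (n - Suc x)"
    if "x < n" "y < n" "z < n" for x y z using that by auto
  have 2: "p132 x y z \<longleftrightarrow> p213 (n - Suc z) (n - Suc y) (n - Suc x)"
    if "x < n" "y < n" "z < n" for x y z using that by auto
  have "(\<Sum>xs\<in>avoiding p213 n. w ^ hits 0 xs) = (\<Sum>xs\<in>avoiding p132 n. w ^ hits 0 xs)"
    by (rule sum.reindex_bij_witness[of _ "rev_complement n" "rev_complement n"])
       (simp_all add: rev_complement_in_avoiding[where Q = p132 and P = p213, OF _ 1]
         rev_complement_in_avoiding[where Q = p213 and P = p132, OF _ 2])
  then show ?thesis by (simp add: sum_hits_0_132)
qed

subsection \<open>The partition function\<close>

lemma contains_length_3: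
  "contains \<sigma> [a, b, c] \<longleftrightarrow> (\<exists>i j k. i < j \<and> j < k \<and> k < length \<sigma> \<and>
     (\<sigma> ! i < \<sigma> ! j \<longleftrightarrow> a < b) \<and> (\<sigma> ! j < \<sigma> ! i \<longleftrightarrow> b < a) \<and>
     (\<sigma> ! i < \<sigma> ! k \<longleftrightarrow> a < c) \<and> (\<sigma> ! k < \<sigma> ! i \<longleftrightarrow> c < a) \<and>
     (\<sigma> ! j < \<sigma> ! k \<longleftrightarrow> b < c) \<and> (\<sigma> ! k < \<sigma> ! j \<longleftrightarrow> c < b))" (is "_ \<longleftrightarrow> ?R")
proof
  assume "contains \<sigma> [a, b, c]"
  then obtain idx where idx: "length idx = 3" "sorted_wrt (<) idx" "\<forall>i\<in>set idx. i < length \<sigma>"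
    and "\<forall>j<3. \<forall>k<3. \<sigma> ! (idx ! j) < \<sigma> ! (idx ! k) \<longleftrightarrow> [a, b, c] ! j < [a, b, c] ! k"
    unfolding contains_def by (auto simp: numeral_3_eq_3)
  moreover obtain i j k where "idx = [i, j, k]"
    using idx(1) by (auto simp: numeral_3_eq_3 length_Suc_conv)
  ultimately show ?R
    by (intro exI[of _ i] exI[of _ j] exI[of _ k])
       (simp add: numeral_3_eq_3 All_less_Suc)
next
  assume ?R
  then obtain i j k where "i < j \<and> j < k \<and> k < length \<sigma> \<and>
     (\<sigma> ! i < \<sigma> ! j \<longleftrightarrow> a < b) \<and> (\<sigma> ! j < \<sigma> ! i \<longleftrightarrow> b < a) \<and>
     (\<sigma> ! i < \<sigma> ! k \<longleftrightarrow> a < c) \<and> (\<sigma> ! k < \<sigma> ! i \<longleftrightarrow> c < a) \<and>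
     (\<sigma> ! j < \<sigma> ! k \<longleftrightarrow> b < c) \<and> (\<sigma> ! k < \<sigma> ! j \<longleftrightarrow> c < b)" by blast
  then show "contains \<sigma> [a, b, c]"
    unfolding contains_def
    by (intro exI[of _ "[i, j, k]"]) (simp add: All_less_Suc)
qed

lemma not_contains_iff_avoids3:
  "\<not> contains \<sigma> [1, 3, 2] \<longleftrightarrow> avoids3 p132 \<sigma>"
  "\<not> contains \<sigma> [2, 1, 3] \<longleftrightarrow> avoids3 p213 \<sigma>"
  "\<not> contains \<sigma> [3, 2, 1] \<longleftrightarrow> avoids3 p321 \<sigma>"
proof -
  have "contains \<sigma> [1, 3, 2] \<longleftrightarrow> (\<exists>i j k. i < j \<and> j < k \<and> k < length \<sigma> \<and> p132 (\<sigma> ! i) (\<sigma> ! j) (\<sigma> ! k))"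
    and "contains \<sigma> [2, 1, 3] \<longleftrightarrow> (\<exists>i j k. i < j \<and> j < k \<and> k < length \<sigma> \<and> p213 (\<sigma> ! i) (\<sigma> ! j) (\<sigma> ! k))"
    and "contains \<sigma> [3, 2, 1] \<longleftrightarrow> (\<exists>i j k. i < j \<and> j < k \<and> k < length \<sigma> \<and> p321 (\<sigma> ! i) (\<sigma> ! j) (\<sigma> ! k))"
    unfolding contains_length_3 by (intro ex_cong1; simp; linarith)+
  then show "\<not> contains \<sigma> [1, 3, 2] \<longleftrightarrow> avoids3 p132 \<sigma>"
    "\<not> contains \<sigma> [2, 1, 3] \<longleftrightarrow> avoids3 p213 \<sigma>"
    "\<not> contains \<sigma> [3, 2, 1] \<longleftrightarrow> avoids3 p321 \<sigma>"
    unfolding avoids3_conv_nth by meson+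
qed

lemma avoiders_eq_image:
  assumes "\<And>\<sigma>. \<not> contains \<sigma> \<tau> \<longleftrightarrow> avoids3 P \<sigma>"
    and "\<And>x y z. P (Suc x) (Suc y) (Suc z) \<longleftrightarrow> P x y z"
  shows "avoiders n \<tau> = map Suc ` avoiding P n"
proof -
  have "{1..n} = Suc ` {..<n}" by (simp add: image_Suc_lessThan)
  then have "Sn n = map Suc ` permutations_of_set {..<n}"
    unfolding Sn_def by (simp add: permutations_of_set_image_inj)
  then show ?thesis
    by (auto simp: avoiders_def assms avoids3_map avoiding_conv_permutations)
qed

lemma fp_map_Suc: "fp (map Suc xs) = hits 0 xs"
proof -
  have "{i \<in> {1..length (map Suc xs)}. map Suc xs ! (i - 1) = i}
      = Suc ` {i. i < length xs \<and> int (xs ! i) = int i + 0}"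
  proof (rule set_eqI)
    fix i show "i \<in> {i \<in> {1..length (map Suc xs)}. map Suc xs ! (i - 1) = i} \<longleftrightarrow>
      i \<in> Suc ` {i. i < length xs \<and> int (xs ! i) = int i + 0}"
      by (cases i) auto
  qed
  then show ?thesis by (simp add: fp_def hits_conv_card card_image)
qed

text \<open>Kept over an arbitrary commutative ring: real \<open>w\<close> gives \<open>Zn\<close>,
  complex \<open>w\<close> the characteristic function.\<close>

lemma sum_fp_avoiders:
  fixes w :: "'a::comm_ring_1"
  assumes "\<tau> \<in> {[1,3,2], [3,2,1], [2,1,3]}"
  shows "(\<Sum>\<sigma>\<in>avoiders n \<tau>. w ^ fp \<sigma>) = ballot_poly (w - 1) n"
proof -
  have *: "(\<Sum>\<sigma>\<in>avoiders n \<tau>. w ^ fp \<sigma>) = (\<Sum>xs\<in>avoiding P n. w ^ hits 0 xs)"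
    if "avoiders n \<tau> = map Suc ` avoiding P n" for P
    unfolding that by (simp add: sum.reindex inj_on_def fp_map_Suc)
  from assms consider "\<tau> = [1,3,2]" | "\<tau> = [3,2,1]" | "\<tau> = [2,1,3]" by blast
  then show ?thesis
  proof cases
    case 1
    show ?thesis
      by (subst *[OF avoiders_eq_image[of _ p132]]) (use 1 not_contains_iff_avoids3 sum_hits_0_132 in auto)
  next
    case 2
    show ?thesis
      by (subst *[OF avoiders_eq_image[of _ p321]]) (use 2 not_contains_iff_avoids3 sum_hits_321 in auto)
  next
    case 3
    show ?thesis
      by (subst *[OF avoiders_eq_image[of _ p213]]) (use 3 not_contains_iff_avoids3 sum_hits_213 in auto)
  qed
qed

subsection \<open>Asymptotics of the partition function\<close>

lemma negative_binomial_series: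
  fixes r :: complex
  assumes "norm r < 1"
  shows "(\<lambda>j. of_nat ((n + j) choose j) * r ^ j) sums (1 / (1 - r) ^ Suc n)"
proof -
  have "(\<lambda>j. ((- of_nat (Suc n)) gchoose j) * (- r) ^ j) sums (1 + (- r)) powr (- of_nat (Suc n))"
    using assms by (intro gen_binomial_complex) simp
  moreover have "((- of_nat (Suc n)) gchoose j) * (- r) ^ j = of_nat ((n + j) choose j) * r ^ j" for j
  proof -
    have "(- of_nat (Suc n)) gchoose j = (- 1) ^ j * (of_nat ((n + j) choose j) :: complex)"
      unfolding gbinomial_minus by (simp add: binomial_gbinomial add_ac)
    moreover have "(- 1) ^ j * (- r) ^ j = r ^ j" by (simp flip: power_mult_distrib)
    ultimately show ?thesis by (metis (no_types, lifting) mult.assoc mult.commute)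
  qed
  moreover have "(1 + (- r)) powr (- of_nat (Suc n)) = 1 / (1 - r) ^ Suc n"
    using assms unfolding powr_minus by (subst powr_nat') (auto simp: field_simps)
  ultimately show ?thesis by simp
qed

text \<open>Continues the ballot number past \<open>j = n\<close>, where the difference may be
  negative, hence the integers; the completed series has a closed form.\<close>

definition binomial_diff :: "nat \<Rightarrow> nat \<Rightarrow> int" where
  "binomial_diff n j = int ((n + j) choose j) - (if j = 0 then 0 else int ((n + j) choose (j - 1)))"

lemma abs_binomial_diff_le: "\<bar>binomial_diff n j\<bar> \<le> 2 ^ (n + j)"
proof -
  have "int ((n + j) choose k) \<le> 2 ^ (n + j)" for k
    using binomial_le_pow2[of "n + j" k] by (metis of_nat_le_iff of_nat_numeral of_nat_power)
  from this[of j] this[of "j - 1"] show ?thesis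
    unfolding binomial_diff_def by (smt (verit) of_nat_0_le_iff)
qed

lemma ballot_eq_binomial_diff:
  assumes "j \<le> n"
  shows "int (ballot (Suc (n - j)) j) = binomial_diff n j"
  using ballot_closed[of "n - j" j] assms
  by (auto simp: binomial_diff_def algebra_simps mult_2 split: if_splits)

lemma ballot_poly_eq_binomial_diff:
  fixes p :: complex
  assumes "p \<noteq> 0"
  shows "ballot_poly p n = p ^ n * (\<Sum>j\<le>n. of_int (binomial_diff n j) * (1 / p) ^ j)"
proof -
  have "ballot_poly p n = (\<Sum>j\<le>n. of_nat (ballot (Suc (n - j)) j) * p ^ (n - j))"
    unfolding ballot_poly_def by (subst sum_reflect_atMost[symmetric]) simp
  also have "\<dots> = (\<Sum>j\<le>n. of_int (binomial_diff n j) * p ^ (n - j))"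
    by (intro sum.cong refl) (simp flip: ballot_eq_binomial_diff)
  also have "\<dots> = p ^ n * (\<Sum>j\<le>n. of_int (binomial_diff n j) * (1 / p) ^ j)"
    unfolding sum_distrib_left using assms
    by (intro sum.cong refl) (simp add: power_diff power_one_over field_simps)
  finally show ?thesis .
qed

lemma binomial_diff_sums:
  fixes r :: complex
  assumes "norm r < 1"
  shows "(\<lambda>j. of_int (binomial_diff n j) * r ^ j) sums ((1 - 2 * r) / (1 - r) ^ (n + 2))"
proof -
  have "r \<noteq> 1" using assms by auto
  \<comment> \<open>At index \<open>Suc j\<close> the binomial is
    \<open>(Suc n + j) choose j\<close>, so this series is \<open>r\<close> times the negative
    binomial series for \<open>Suc n\<close>.\<close>
  have "(\<lambda>j. (if j = 0 then 0 else of_nat ((n + j) choose (j - 1))) * r ^ j) sums (r * (1 / (1 - r) ^ (n + 2)))"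
    using sums_Suc[of "\<lambda>j. (if j = 0 then 0 else of_nat ((n + j) choose (j - 1))) * r ^ j"]
      sums_mult[OF negative_binomial_series[OF assms, of "Suc n"], of r]
    by (simp add: mult_ac)
  from sums_diff[OF negative_binomial_series[OF assms, of n] this]
  have "(\<lambda>j. of_int (binomial_diff n j) * r ^ j) sums (1 / (1 - r) ^ Suc n - r * (1 / (1 - r) ^ (n + 2)))"
    by (rule sums_cong[THEN iffD1, rotated]) (auto simp: binomial_diff_def left_diff_distrib)
  also have "1 / (1 - r) ^ Suc n - r * (1 / (1 - r) ^ (n + 2)) = (1 - 2 * r) / (1 - r) ^ (n + 2)"
    using \<open>r \<noteq> 1\<close> by (simp add: divide_simps)
  finally show ?thesis .
qed

text \<open>By \<open>abs_binomial_diff_le\<close> the terms with \<open>j > n\<close> are dominated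
  by a geometric series of ratio \<open>2 * norm r\<close>, beginning at
  \<open>2 ^ n * (2 * norm r) ^ Suc n\<close>.\<close>

lemma binomial_diff_tail:
  fixes r :: complex
  assumes "norm r < 1 / 2"
  shows "norm ((\<Sum>j\<le>n. of_int (binomial_diff n j) * r ^ j) - (1 - 2 * r) / (1 - r) ^ (n + 2))
           \<le> (4 * norm r) ^ n * (2 * norm r / (1 - 2 * norm r))"
proof -
  let ?f = "\<lambda>j. of_int (binomial_diff n j) * r ^ j"
  have "(\<lambda>i. ?f (i + Suc n)) sums ((1 - 2 * r) / (1 - r) ^ (n + 2) - (\<Sum>j<Suc n. ?f j))"
    using assms by (intro sums_split_initial_segment binomial_diff_sums) simp
  moreover have "(\<lambda>i. 2 ^ n * (2 * norm r) ^ Suc n * (2 * norm r) ^ i) sums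
      (2 ^ n * (2 * norm r) ^ Suc n * (1 / (1 - 2 * norm r)))"
    using assms by (intro sums_mult geometric_sums) simp
  moreover have "norm (?f (i + Suc n)) \<le> 2 ^ n * (2 * norm r) ^ Suc n * (2 * norm r) ^ i" for i
  proof -
    have "norm (?f (i + Suc n)) \<le> 2 ^ (n + (i + Suc n)) * norm r ^ (i + Suc n)"
      unfolding norm_mult norm_power norm_of_int
      using abs_binomial_diff_le[of n "i + Suc n"]
      by (intro mult_right_mono) (metis of_int_abs of_int_le_iff of_int_numeral of_int_power, simp)
    also have "\<dots> = 2 ^ n * (2 * norm r) ^ Suc n * (2 * norm r) ^ i"
      by (simp add: power_add power_mult_distrib)
    finally show ?thesis .
  qed
  ultimately have "norm ((1 - 2 * r) / (1 - r) ^ (n + 2) - (\<Sum>j<Suc n. ?f j))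
      \<le> 2 ^ n * (2 * norm r) ^ Suc n * (1 / (1 - 2 * norm r))"
    by (metis (no_types, lifting) norm_suminf_le sums_iff)
  also have "\<dots> = (4 * norm r) ^ n * (2 * norm r / (1 - 2 * norm r))"
  proof -
    have "(4 :: real) ^ n = 2 ^ n * 2 ^ n" by (simp flip: power_mult_distrib)
    then show ?thesis by (simp add: power_mult_distrib)
  qed
  finally show ?thesis
    by (simp add: norm_minus_commute lessThan_Suc_atMost)
qed

lemma tendsto_power_0:
  fixes x :: "nat \<Rightarrow> real"
  assumes "x \<longlonglongrightarrow> a" "\<bar>a\<bar> < 1"
  shows "(\<lambda>n. x n ^ n) \<longlonglongrightarrow> 0"
proof -
  obtain c where c: "\<bar>a\<bar> < c" "c < 1" using assms(2) dense by blast
  have "eventually (\<lambda>n. \<bar>x n\<bar> < c) sequentially"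
    using tendsto_rabs[OF assms(1)] c(1) by (rule order_tendstoD)
  then have "eventually (\<lambda>n. norm (x n ^ n) \<le> c ^ n) sequentially"
    by eventually_elim (simp add: power_abs power_mono)
  moreover have "(\<lambda>n. c ^ n) \<longlonglongrightarrow> 0" using c by (intro LIMSEQ_realpow_zero) auto
  ultimately show ?thesis by (rule Lim_null_comparison)
qed

text \<open>With \<open>r = 1 / p\<close> close to \<open>1 / a < 1 / 2\<close>, the series defining \<open>ballot_poly p n\<close> differs from
  the full negative binomial series by at most a constant times \<open>(4 |r|)^n\<close>, which is negligible
  against \<open>|1 - r|^(-n)\<close> because \<open>4 r (1 - r) < 1\<close>.\<close>

lemma ballot_poly_asymptotics:
  fixes p :: "nat \<Rightarrow> complex" and a :: real
  assumes p: "p \<longlonglongrightarrow> of_real a" and a: "a > 2"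
  shows "(\<lambda>n. ballot_poly (p n) n * ((p n - 1) / (p n)\<^sup>2) ^ n) \<longlonglongrightarrow> of_real (a * (a - 2) / (a - 1)\<^sup>2)"
proof -
  define r where "r n = 1 / p n" for n
  define T where "T n = (\<Sum>j\<le>n. of_int (binomial_diff n j) * r n ^ j)" for n
  define b where "b = 1 / a"
  have b: "0 < b" "b < 1 / 2" using a by (auto simp: b_def field_simps)
  have r: "r \<longlonglongrightarrow> of_real b"
    unfolding r_def b_def of_real_divide of_real_1 using a by (intro tendsto_intros p) auto
  have nr: "(\<lambda>n. norm (r n)) \<longlonglongrightarrow> b" using tendsto_norm[OF r] b by simp
  have "eventually (\<lambda>n. p n \<noteq> 0) sequentially"
    using tendsto_imp_eventually_ne[OF p, of 0] a by simp
  moreover have "eventually (\<lambda>n. norm (r n) < 1 / 2) sequentially"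
    using nr b(2) by (rule order_tendstoD)
  ultimately have ev: "eventually (\<lambda>n. norm ((1 - r n) ^ n * T n - (1 - 2 * r n) / (1 - r n)\<^sup>2)
      \<le> (4 * norm (r n) * norm (1 - r n)) ^ n * (2 * norm (r n) / (1 - 2 * norm (r n)))
      \<and> ballot_poly (p n) n * ((p n - 1) / (p n)\<^sup>2) ^ n = (1 - r n) ^ n * T n) sequentially"
  proof eventually_elim
    case (elim n)
    then have r1: "1 - r n \<noteq> 0" by auto
    have "(1 - r n) ^ n * ((1 - 2 * r n) / (1 - r n) ^ (n + 2)) = (1 - 2 * r n) / (1 - r n)\<^sup>2"
      using r1 by (simp add: power_add power2_eq_square)
    then have "(1 - r n) ^ n * T n - (1 - 2 * r n) / (1 - r n)\<^sup>2
       = (1 - r n) ^ n * (T n - (1 - 2 * r n) / (1 - r n) ^ (n + 2))"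
      by (simp only: right_diff_distrib)
    then have "norm ((1 - r n) ^ n * T n - (1 - 2 * r n) / (1 - r n)\<^sup>2)
       = norm (1 - r n) ^ n * norm (T n - (1 - 2 * r n) / (1 - r n) ^ (n + 2))"
      by (simp add: norm_mult norm_power)
    also have "\<dots> \<le> norm (1 - r n) ^ n * ((4 * norm (r n)) ^ n * (2 * norm (r n) / (1 - 2 * norm (r n))))"
      unfolding T_def using elim by (intro mult_left_mono binomial_diff_tail) auto
    also have "\<dots> = (4 * norm (r n) * norm (1 - r n)) ^ n * (2 * norm (r n) / (1 - 2 * norm (r n)))"
      by (simp add: power_mult_distrib)
    finally have 1: "norm ((1 - r n) ^ n * T n - (1 - 2 * r n) / (1 - r n)\<^sup>2) \<le> \<dots>" .
    have "p n * ((p n - 1) / (p n)\<^sup>2) = 1 - r n"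
      using elim by (simp add: r_def field_simps power2_eq_square)
    then have "p n ^ n * ((p n - 1) / (p n)\<^sup>2) ^ n = (1 - r n) ^ n"
      by (metis power_mult_distrib)
    then have "ballot_poly (p n) n * ((p n - 1) / (p n)\<^sup>2) ^ n = (1 - r n) ^ n * T n"
      using elim by (simp add: ballot_poly_eq_binomial_diff T_def r_def mult_ac)
    with 1 show ?case by blast
  qed
  have "(\<lambda>n. (4 * norm (r n) * norm (1 - r n)) ^ n) \<longlonglongrightarrow> 0"
  proof (rule tendsto_power_0)
    show "(\<lambda>n. 4 * norm (r n) * norm (1 - r n)) \<longlonglongrightarrow> 4 * b * norm (1 - complex_of_real b)"
      by (intro tendsto_intros r nr)
    have "norm (1 - complex_of_real b) = 1 - b"
      using b norm_of_real[of "1 - b", where 'a = complex] by simp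
    \<comment> \<open>\<open>b < 1 / 2\<close> keeps this square positive, so the error decays
      geometrically.\<close>
    moreover have "4 * b * (1 - b) = 1 - (1 - 2 * b)\<^sup>2" by (simp add: power2_eq_square algebra_simps)
    moreover have "(1 - 2 * b)\<^sup>2 > 0" "4 * b * (1 - b) > 0" using b by auto
    ultimately show "\<bar>4 * b * norm (1 - complex_of_real b)\<bar> < 1" by simp
  qed
  moreover have "(\<lambda>n. 2 * norm (r n) / (1 - 2 * norm (r n))) \<longlonglongrightarrow> 2 * b / (1 - 2 * b)"
    using b by (intro tendsto_intros nr) auto
  ultimately have "(\<lambda>n. (4 * norm (r n) * norm (1 - r n)) ^ n * (2 * norm (r n) / (1 - 2 * norm (r n))))
     \<longlonglongrightarrow> 0 * (2 * b / (1 - 2 * b))"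
    by (rule tendsto_mult)
  from Lim_null_comparison[OF ev[unfolded eventually_conj_iff, THEN conjunct1] this[unfolded mult_zero_left]]
  have "(\<lambda>n. (1 - r n) ^ n * T n - (1 - 2 * r n) / (1 - r n)\<^sup>2) \<longlonglongrightarrow> 0" .
  moreover have "(\<lambda>n. (1 - 2 * r n) / (1 - r n)\<^sup>2) \<longlonglongrightarrow> (1 - 2 * of_real b) / (1 - of_real b)\<^sup>2"
  proof (intro tendsto_intros r)
    have "complex_of_real (1 - b) \<noteq> 0" unfolding of_real_eq_0_iff using b by simp
    then show "(1 - complex_of_real b)\<^sup>2 \<noteq> 0" by simp
  qed
  ultimately have "(\<lambda>n. (1 - r n) ^ n * T n) \<longlonglongrightarrow> (1 - 2 * of_real b) / (1 - of_real b)\<^sup>2"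
    by (rule Lim_transform[rotated])
  moreover have "(1 - 2 * of_real b) / (1 - of_real b)\<^sup>2 = complex_of_real (a * (a - 2) / (a - 1)\<^sup>2)"
  proof -
    have "(1 - 2 * b) / (1 - b)\<^sup>2 = a * (a - 2) / (a - 1)\<^sup>2"
      using a by (simp add: b_def divide_simps power2_eq_square)
    from arg_cong[OF this, of complex_of_real] show ?thesis
      by (simp only: of_real_divide of_real_diff of_real_1 of_real_mult of_real_numeral of_real_power)
  qed
  ultimately show ?thesis
    unfolding tendsto_cong[OF ev[unfolded eventually_conj_iff, THEN conjunct2]] by (simp only:)
qed

subsection \<open>The characteristic function\<close>

lemma powser_second_order:
  fixes f :: "complex \<Rightarrow> complex"
  assumes "0 < s" "\<And>z. norm z < s \<Longrightarrow> (\<lambda>n. c n * z ^ n) sums f z"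
  shows "((\<lambda>z. (f z - c 0 - c 1 * z) / z\<^sup>2) \<longlongrightarrow> c 2) (at 0)"
proof -
  have "((\<lambda>z. (f z - c 0 - c 1 * z) / z\<^sup>2) \<longlongrightarrow> c (0 + 2)) (at 0)"
  proof (rule powser_limit_0_strong[OF assms(1), where a = "\<lambda>n. c (n + 2)"])
    fix z :: complex assume z: "z \<noteq> 0" "norm z < s"
    from sums_divide[OF sums_split_initial_segment[OF assms(2)[OF z(2)], of 2], of "z\<^sup>2"] z(1)
    show "(\<lambda>n. c (n + 2) * z ^ n) sums ((f z - c 0 - c 1 * z) / z\<^sup>2)"
      by (simp add: power_add numeral_2_eq_2 algebra_simps)
  qed
  then show ?thesis by (simp only: add_0)
qed

lemma exp_second_order: "((\<lambda>z. (exp z - 1 - z) / z\<^sup>2) \<longlongrightarrow> 1 / 2) (at (0 :: complex))"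
  using powser_second_order[of 1 "\<lambda>n. 1 / fact n" exp] exp_converges[where 'a = complex]
  by (simp add: scaleR_conv_of_real field_simps fact_numeral numeral_2_eq_2)

lemma Ln_second_order: "((\<lambda>z. (Ln (1 + z) - z) / z\<^sup>2) \<longlongrightarrow> - 1 / 2) (at 0)"
proof -
  have *: "- ((- 1) ^ n) / of_nat n * z ^ n = - ((- z) ^ n) / of_nat n" for z :: complex and n
    by (cases "even n") simp_all
  \<comment> \<open>The coefficient at index 0 is a division by zero and hence 0, as the expansion
    requires.\<close>
  have "((\<lambda>z. (Ln (1 + z) - (- ((- 1) ^ 0) / of_nat 0) - (- ((- 1) ^ 1) / of_nat 1) * z) / z\<^sup>2)
      \<longlongrightarrow> - ((- 1) ^ 2) / of_nat 2) (at 0)"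
    by (intro powser_second_order[of 1]) (simp, simp only: * Ln_series')
  then show ?thesis by simp
qed

text \<open>For real \<open>a\<close> in the unit interval this expands the logarithm of a Bernoulli
  characteristic function, with mean \<open>a\<close> and variance
  \<open>a - a\<^sup>2\<close>.\<close>

lemma Ln_affine_exp_second_order:
  fixes a :: complex
  assumes "a \<noteq> 0"
  shows "((\<lambda>z. (Ln (1 + a * (exp (\<i> * z) - 1)) - \<i> * a * z) / z\<^sup>2) \<longlongrightarrow> - (a - a\<^sup>2) / 2) (at 0)"
proof -
  define u where "u z = a * (exp (\<i> * z) - 1)" for z
  have iz: "filterlim (\<lambda>z :: complex. \<i> * z) (at 0) (at 0)"
    by (auto simp: filterlim_at eventually_at_filter intro!: tendsto_eq_intros)
  have E: "((\<lambda>z. (exp (\<i> * z) - 1 - \<i> * z) / (\<i> * z)\<^sup>2) \<longlongrightarrow> 1 / 2) (at 0)"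
    by (rule filterlim_compose[OF exp_second_order iz])
  have "((\<lambda>z. a * \<i> + a * ((exp (\<i> * z) - 1 - \<i> * z) / (\<i> * z)\<^sup>2) * (- z)) \<longlongrightarrow> a * \<i> + a * (1 / 2) * (- 0)) (at 0)"
    by (intro tendsto_intros E)
  moreover have "eventually (\<lambda>z. a * \<i> + a * ((exp (\<i> * z) - 1 - \<i> * z) / (\<i> * z)\<^sup>2) * (- z) = u z / z) (at 0)"
    by (auto simp: eventually_at_filter u_def field_simps power2_eq_square)
  ultimately have uz: "((\<lambda>z. u z / z) \<longlongrightarrow> a * \<i>) (at 0)"
    by (simp add: tendsto_cong)
  have "((\<lambda>z. u z / z * z) \<longlongrightarrow> a * \<i> * 0) (at 0)" by (intro tendsto_mult uz tendsto_ident_at)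
  moreover have "eventually (\<lambda>z. u z / z * z = u z) (at 0)"
    by (simp add: eventually_at_filter)
  ultimately have "(u \<longlongrightarrow> 0) (at 0)"
    by (simp add: tendsto_cong)
  \<comment> \<open>The quotient \<open>u z / z\<close> has the nonzero limit
    \<open>a * \<i>\<close>, so \<open>u\<close> avoids 0 near 0 and the punctured limit of
    \<open>Ln_second_order\<close> composes with it.\<close>
  moreover have "eventually (\<lambda>z. u z \<noteq> 0) (at 0)"
    using tendsto_imp_eventually_ne[OF uz, of 0] assms by (auto elim: eventually_mono)
  ultimately have "filterlim u (at 0) (at 0)" by (simp add: filterlim_at)
  from filterlim_compose[OF Ln_second_order this]
  have L: "((\<lambda>z. (Ln (1 + u z) - u z) / (u z)\<^sup>2) \<longlongrightarrow> - 1 / 2) (at 0)" .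
  \<comment> \<open>The target is \<open>(Ln (1 + u z) - u z) / z\<^sup>2\<close> plus
    \<open>(u z - \<i> * a * z) / z\<^sup>2\<close>, and the latter is \<open>- a\<close> times the
    remainder quotient of \<open>exp\<close>.\<close>
  have M: "((\<lambda>z. (Ln (1 + u z) - u z) / (u z)\<^sup>2 * (u z / z)\<^sup>2 - a * ((exp (\<i> * z) - 1 - \<i> * z) / (\<i> * z)\<^sup>2))
     \<longlongrightarrow> - 1 / 2 * (a * \<i>)\<^sup>2 - a * (1 / 2)) (at 0)"
    by (intro tendsto_intros L E uz)
  have V: "- 1 / 2 * (a * \<i>)\<^sup>2 - a * (1 / 2) = - (a - a\<^sup>2) / 2"
    by (simp add: power_mult_distrib field_simps)
  have "eventually (\<lambda>z. (Ln (1 + u z) - u z) / (u z)\<^sup>2 * (u z / z)\<^sup>2 - a * ((exp (\<i> * z) - 1 - \<i> * z) / (\<i> * z)\<^sup>2)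
     = (Ln (1 + u z) - \<i> * a * z) / z\<^sup>2) (at 0)"
    using \<open>eventually (\<lambda>z. u z \<noteq> 0) (at 0)\<close> eventually_neq_at_within[of 0 0]
  proof eventually_elim
    case (elim z)
    have "(Ln (1 + u z) - u z) / (u z)\<^sup>2 * (u z / z)\<^sup>2 = (Ln (1 + u z) - u z) / z\<^sup>2"
      using elim by (simp add: power_divide)
    moreover have "a * ((exp (\<i> * z) - 1 - \<i> * z) / (\<i> * z)\<^sup>2) = - (u z - \<i> * a * z) / z\<^sup>2"
    proof -
      have "(\<i> * z)\<^sup>2 = - z\<^sup>2" by (simp add: power_mult_distrib)
      moreover have "a * (exp (\<i> * z) - 1 - \<i> * z) = u z - \<i> * a * z"
        by (simp add: u_def algebra_simps)
      ultimately show ?thesis by (metis divide_minus_right minus_divide_left times_divide_eq_right)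
    qed
    ultimately show ?case by (simp add: diff_divide_distrib)
  qed
  from Lim_transform_eventually[OF M this] show ?thesis
    unfolding V by (simp only: u_def)
qed

section \<open>The weighted law and its characteristic function\<close>

lemma ballot_poly_of_real: "ballot_poly (of_real x :: complex) n = of_real (ballot_poly x n)"
  by (simp add: ballot_poly_def)

lemma ballot_poly_pos:
  fixes p :: real
  assumes "p > 0"
  shows "ballot_poly p n > 0"
proof -
  have "0 < of_nat (ballot (Suc n) (n - n)) * p ^ n" using assms by simp
  also have "\<dots> \<le> ballot_poly p n"
    unfolding ballot_poly_def using assms by (intro member_le_sum) auto
  finally show ?thesis .
qed

context
  fixes q :: real and \<tau> :: "nat list"
  assumes q: "q > 1" and \<tau>: "\<tau> \<in> {[1,3,2], [3,2,1], [2,1,3]}"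
begin

lemma Zn_eq: "Zn n q \<tau> = ballot_poly (q - 1) n"
  unfolding Zn_def by (rule sum_fp_avoiders[OF \<tau>])

lemma Zn_pos: "Zn n q \<tau> > 0"
  using q by (simp add: Zn_eq ballot_poly_pos)

lemma finite_avoiders: "finite (avoiders n \<tau>)"
  by (rule finite_subset[of _ "Sn n"]) (auto simp: avoiders_def Sn_def)

lemma Pn_eq: "Pn n q \<tau> = point_measure (avoiders n \<tau>) (\<lambda>\<sigma>. q ^ fp \<sigma> / Zn n q \<tau>)"
  by (simp add: Pn_def point_measure_def)

lemma prob_space_Pn: "prob_space (Pn n q \<tau>)"
  unfolding Pn_eq
proof (rule prob_space_point_measure)
  have "(\<Sum>\<sigma>\<in>avoiders n \<tau>. q ^ fp \<sigma> / Zn n q \<tau>) = 1"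
    using Zn_pos[of n] by (simp add: sum_divide_distrib[symmetric] Zn_def)
  moreover have "0 \<le> q ^ fp \<sigma> / Zn n q \<tau>" for \<sigma>
    using q Zn_pos[of n] by simp
  ultimately show "(\<Sum>\<sigma>\<in>avoiders n \<tau>. ennreal (q ^ fp \<sigma> / Zn n q \<tau>)) = 1"
    by (simp add: sum_ennreal)
qed (simp_all add: finite_avoiders)

lemma measurable_Pn [measurable]: "f \<in> Pn n q \<tau> \<rightarrow>\<^sub>M borel"
  by (simp add: Pn_eq measurable_def space_point_measure sets_point_measure)

text \<open>The oscillating factor in \<open>fp \<sigma>\<close> merges with the weight
  \<open>q ^ fp \<sigma>\<close> into a power of \<open>q * exp (\<i> * (t / s))\<close>, so the
  expectation is a quotient of two partition functions.\<close>

lemma char_fp: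
  "char (distr (Pn n q \<tau>) borel (\<lambda>\<sigma>. (real (fp \<sigma>) - m * real n) / s)) t =
     exp (- (\<i> * of_real (t / s) * of_real m)) ^ n
       * ballot_poly (of_real q * exp (\<i> * of_real (t / s)) - 1) n / ballot_poly (of_real q - 1) n"
proof -
  \<comment> \<open>Valid for \<open>s = 0\<close> too, since division by 0 gives 0; this occurs at
    \<open>n = 0\<close>.\<close>
  have e: "iexp (t * ((real k - m * real n) / s)) =
      exp (- (\<i> * of_real (t / s) * of_real m)) ^ n * exp (\<i> * of_real (t / s)) ^ k" for k
    unfolding exp_of_nat_mult[symmetric] exp_add[symmetric]
    by (intro arg_cong[where f = exp]) (simp add: field_simps diff_divide_distrib)
  have "char (distr (Pn n q \<tau>) borel (\<lambda>\<sigma>. (real (fp \<sigma>) - m * real n) / s)) t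
     = (\<Sum>\<sigma>\<in>avoiders n \<tau>. (q ^ fp \<sigma> / Zn n q \<tau>) *\<^sub>R iexp (t * ((real (fp \<sigma>) - m * real n) / s)))"
    unfolding char_def
  proof (subst integral_distr)
    show "(\<integral>\<sigma>. iexp (t * ((real (fp \<sigma>) - m * real n) / s)) \<partial>Pn n q \<tau>)
      = (\<Sum>\<sigma>\<in>avoiders n \<tau>. (q ^ fp \<sigma> / Zn n q \<tau>) *\<^sub>R iexp (t * ((real (fp \<sigma>) - m * real n) / s)))"
      unfolding Pn_eq using q Zn_pos[of n]
      by (intro lebesgue_integral_point_measure_finite finite_avoiders) simp
  qed measurable
  also have "\<dots> = exp (- (\<i> * of_real (t / s) * of_real m)) ^ n
     * (\<Sum>\<sigma>\<in>avoiders n \<tau>. (of_real q * exp (\<i> * of_real (t / s))) ^ fp \<sigma>) / of_real (Zn n q \<tau>)"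
    unfolding e sum_distrib_left sum_divide_distrib
    by (intro sum.cong refl) (simp add: scaleR_conv_of_real power_mult_distrib)
  also have "complex_of_real (Zn n q \<tau>) = ballot_poly (of_real q - 1) n"
    unfolding Zn_eq by (simp flip: ballot_poly_of_real)
  finally show ?thesis unfolding sum_fp_avoiders[OF \<tau>] .
qed

end

text \<open>With \<open>p = q - 1\<close> and \<open>p' = q * exp (\<i> * z) - 1\<close>, the quotients \<open>p' / p\<close> and \<open>(p' - 1) / (p - 1)\<close>
  equal \<open>tilted_base (q / (q - 1)) z\<close> and \<open>tilted_base (q / (q - 2)) z\<close>.\<close>

definition tilted_base :: "real \<Rightarrow> complex \<Rightarrow> complex" where
  "tilted_base a z = 1 + of_real a * (exp (\<i> * z) - 1)"

text \<open>With \<open>a = q / (q - 1)\<close> and \<open>b = q / (q - 2)\<close>, the logarithm of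
  the base loses its linear term because \<open>m = 2 * a - b\<close>, and its quadratic coefficient
  is \<open>- v / 2\<close>; \<open>n\<close> times the squared angle is
  \<open>t\<^sup>2 / v\<close>.\<close>

lemma tilted_power_limit:
  fixes q t :: real
  assumes q: "q > 3"
  defines "m \<equiv> q * (q - 3) / ((q - 1) * (q - 2))"
    and "v \<equiv> 2 * q * (2 * q - 3) / ((q - 1)\<^sup>2 * (q - 2)\<^sup>2)"
  shows "(\<lambda>n. (exp (- (\<i> * of_real (t / sqrt (v * real n)) * of_real m))
       * (tilted_base (q / (q - 1)) (of_real (t / sqrt (v * real n))))\<^sup>2
       / tilted_base (q / (q - 2)) (of_real (t / sqrt (v * real n)))) ^ n) \<longlonglongrightarrow> of_real (exp (- t\<^sup>2 / 2))"
proof (cases "t = 0")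
  \<comment> \<open>At \<open>t = 0\<close> the angle is identically 0, so limits at the punctured
    point do not apply; the base equals 1.\<close>
  case True
  then show ?thesis by (simp add: tilted_base_def)
next
  case False
  define a b where "a = q / (q - 1)" and "b = q / (q - 2)"
  have ab: "a \<noteq> 0" "b \<noteq> 0" using q by (auto simp: a_def b_def)
  have v: "v > 0" using q by (simp add: v_def)
  define \<theta> :: "nat \<Rightarrow> complex" where "\<theta> n = of_real (t / sqrt (v * real n))" for n
  have sq: "(\<theta> n)\<^sup>2 * of_nat n = of_real (t\<^sup>2 / v)" if "n > 0" for n
  proof -
    have "(t / sqrt (v * real n))\<^sup>2 * n = t\<^sup>2 / v" using v that by (simp add: power_divide)
    then show ?thesis unfolding \<theta>_def by (metis of_real_mult of_real_of_nat_eq of_real_power)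
  qed
  have "(\<lambda>n. t / sqrt (v * real n)) \<longlonglongrightarrow> 0"
    using v by real_asymp
  then have "\<theta> \<longlonglongrightarrow> 0" unfolding \<theta>_def by (metis of_real_0 tendsto_of_real)
  moreover have ne: "eventually (\<lambda>n. \<theta> n \<noteq> 0) sequentially"
    using eventually_gt_at_top[of 0] by eventually_elim (use v False in \<open>auto simp: \<theta>_def\<close>)
  ultimately have \<theta>: "filterlim \<theta> (at 0) sequentially" by (simp add: filterlim_at)
  define h where "h z = 2 * (Ln (tilted_base a z) - \<i> * a * z) - (Ln (tilted_base b z) - \<i> * b * z)" for z
  have "((\<lambda>z. 2 * ((Ln (tilted_base a z) - \<i> * a * z) / z\<^sup>2) - (Ln (tilted_base b z) - \<i> * b * z) / z\<^sup>2)
      \<longlongrightarrow> 2 * (- (of_real a - (of_real a)\<^sup>2) / 2) - (- (of_real b - (of_real b)\<^sup>2) / 2)) (at 0)"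
    unfolding tilted_base_def using ab by (intro tendsto_intros Ln_affine_exp_second_order) auto
  also have "(\<lambda>z. 2 * ((Ln (tilted_base a z) - \<i> * a * z) / z\<^sup>2) - (Ln (tilted_base b z) - \<i> * b * z) / z\<^sup>2) = (\<lambda>z. h z / z\<^sup>2)"
    by (simp add: h_def diff_divide_distrib fun_eq_iff)
  also have "2 * (- (of_real a - (of_real a)\<^sup>2) / 2) - (- (of_real b - (of_real b)\<^sup>2) / 2) = complex_of_real (- v / 2)"
  proof -
    have "2 * (- (a - a\<^sup>2) / 2) - (- (b - b\<^sup>2) / 2) = - v / 2"
      using q unfolding a_def b_def v_def
      by (simp add: divide_simps power2_eq_square) (simp add: algebra_simps)
    from arg_cong[OF this, of complex_of_real] show ?thesis
      by (simp only: of_real_divide of_real_diff of_real_minus of_real_mult of_real_numeral of_real_power)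
  qed
  finally have "((\<lambda>z. h z / z\<^sup>2) \<longlongrightarrow> of_real (- v / 2)) (at 0)" .
  from filterlim_compose[OF this \<theta>]
  have "(\<lambda>n. exp (of_real (t\<^sup>2 / v) * (h (\<theta> n) / (\<theta> n)\<^sup>2))) \<longlonglongrightarrow> exp (of_real (t\<^sup>2 / v) * of_real (- v / 2))"
    by (intro tendsto_intros)
  also have "exp (complex_of_real (t\<^sup>2 / v) * of_real (- v / 2)) = of_real (exp (- t\<^sup>2 / 2))"
    using v by (simp flip: of_real_mult exp_of_real of_real_minus of_real_power of_real_divide)
  finally have lim: "(\<lambda>n. exp (of_real (t\<^sup>2 / v) * (h (\<theta> n) / (\<theta> n)\<^sup>2))) \<longlonglongrightarrow> of_real (exp (- t\<^sup>2 / 2))" .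
  have ne_base: "eventually (\<lambda>n. tilted_base c (\<theta> n) \<noteq> 0) sequentially" for c
  proof -
    have "(\<lambda>n. tilted_base c (\<theta> n)) \<longlonglongrightarrow> 1 + of_real c * (exp (\<i> * 0) - 1)"
      unfolding tilted_base_def by (intro tendsto_intros \<open>\<theta> \<longlonglongrightarrow> 0\<close>)
    from tendsto_imp_eventually_ne[OF this, of 0] show ?thesis by simp
  qed
  have m: "m = 2 * a - b"
    using q unfolding m_def a_def b_def by (simp add: divide_simps) (simp add: algebra_simps)
  \<comment> \<open>Only exponentials of integer multiples of \<open>Ln\<close> appear, so the
    choice of branch is immaterial.\<close>
  have "eventually (\<lambda>n. exp (of_real (t\<^sup>2 / v) * (h (\<theta> n) / (\<theta> n)\<^sup>2))
     = (exp (- (\<i> * \<theta> n * of_real m)) * (tilted_base a (\<theta> n))\<^sup>2 / tilted_base b (\<theta> n)) ^ n) sequentially"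
    using ne ne_base[of a] ne_base[of b] eventually_gt_at_top[of 0]
  proof eventually_elim
    case (elim n)
    have e1: "of_real (t\<^sup>2 / v) * (h (\<theta> n) / (\<theta> n)\<^sup>2) = of_nat n * h (\<theta> n)"
      unfolding sq[OF elim(4), symmetric] using elim by simp
    have e2: "h (\<theta> n) = - (\<i> * \<theta> n * of_real m) + (Ln (tilted_base a (\<theta> n)) + Ln (tilted_base a (\<theta> n))) - Ln (tilted_base b (\<theta> n))"
      by (simp add: h_def m algebra_simps)
    show ?case
      unfolding e1 unfolding e2 exp_of_nat_mult exp_add exp_diff power2_eq_square exp_Ln[OF elim(2)] exp_Ln[OF elim(3)] ..
  qed
  from Lim_transform_eventually[OF lim this] show ?thesis
    unfolding \<theta>_def a_def b_def .
qed

theorem theorem5: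
  fixes q :: real and \<tau> :: "nat list"
  assumes "q > 3"
    and "\<tau> \<in> {[1,3,2], [3,2,1], [2,1,3]}"
  shows "weak_conv_m
    (\<lambda>n. distr (Pn n q \<tau>) borel
       (\<lambda>\<sigma>. (real (fp \<sigma>) - q * (q - 3) / ((q - 1) * (q - 2)) * real n)
             / sqrt (2 * q * (2 * q - 3) / ((q - 1)^2 * (q - 2)^2) * real n)))
    std_normal_distribution"
proof (rule levy_continuity)
  define m where "m = q * (q - 3) / ((q - 1) * (q - 2))"
  define v where "v = 2 * q * (2 * q - 3) / ((q - 1)\<^sup>2 * (q - 2)\<^sup>2)"
  have q: "q > 1" using assms(1) by simp
  show "real_distribution (distr (Pn n q \<tau>) borel
       (\<lambda>\<sigma>. (real (fp \<sigma>) - q * (q - 3) / ((q - 1) * (q - 2)) * real n)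
             / sqrt (2 * q * (2 * q - 3) / ((q - 1)^2 * (q - 2)^2) * real n)))" for n
    using prob_space.real_distribution_distr[OF prob_space_Pn[OF q assms(2)] measurable_Pn[OF q assms(2)]] .
  show "real_distribution std_normal_distribution" by (rule real_dist_normal_dist)
  show "(\<lambda>n. char (distr (Pn n q \<tau>) borel
       (\<lambda>\<sigma>. (real (fp \<sigma>) - q * (q - 3) / ((q - 1) * (q - 2)) * real n)
             / sqrt (2 * q * (2 * q - 3) / ((q - 1)^2 * (q - 2)^2) * real n))) t)
    \<longlonglongrightarrow> char std_normal_distribution t" for t
    unfolding m_def[symmetric] v_def[symmetric] char_fp[OF q assms(2)] char_std_normal_distribution
  proof -
    define \<theta> :: "nat \<Rightarrow> complex" where "\<theta> n = of_real (t / sqrt (v * real n))" for n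
    define p where "p n = of_real q * exp (\<i> * \<theta> n) - 1" for n
    \<comment> \<open>Common limit of the normalised partition functions at \<open>p n\<close> and
      at \<open>q - 1\<close>; \<open>q > 3\<close> makes it nonzero, so it cancels in the
      quotient.\<close>
    define K where "K = complex_of_real ((q - 1) * ((q - 1) - 2) / ((q - 1) - 1)\<^sup>2)"
    let ?A = "\<lambda>p n. ballot_poly p n * ((p - 1) / p\<^sup>2) ^ n"
    have v: "v > 0" using assms(1) by (simp add: v_def)
    have "(\<lambda>n. t / sqrt (v * real n)) \<longlonglongrightarrow> 0" using v by real_asymp
    then have "\<theta> \<longlonglongrightarrow> 0" unfolding \<theta>_def by (metis of_real_0 tendsto_of_real)
    then have "p \<longlonglongrightarrow> of_real q * exp (\<i> * 0) - 1" unfolding p_def by (intro tendsto_intros)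
    then have p: "p \<longlonglongrightarrow> of_real (q - 1)" by simp
    have "(\<lambda>n. ?A (p n) n) \<longlonglongrightarrow> K"
      unfolding K_def using assms(1) by (intro ballot_poly_asymptotics p) simp
    moreover have "(\<lambda>n. ?A (of_real (q - 1)) n) \<longlonglongrightarrow> K"
      unfolding K_def using assms(1) by (intro ballot_poly_asymptotics tendsto_const) simp
    moreover have "K \<noteq> 0" unfolding K_def of_real_eq_0_iff using assms(1) by simp
    ultimately have "(\<lambda>n. ?A (p n) n / ?A (of_real (q - 1)) n * (exp (- (\<i> * \<theta> n * of_real m))
       * (tilted_base (q / (q - 1)) (\<theta> n))\<^sup>2 / tilted_base (q / (q - 2)) (\<theta> n)) ^ n)
       \<longlonglongrightarrow> K / K * of_real (exp (- t\<^sup>2 / 2))"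
      unfolding \<theta>_def m_def v_def using tilted_power_limit[OF assms(1), of t]
      by (intro tendsto_mult tendsto_divide)
    moreover have "eventually (\<lambda>n. ?A (p n) n / ?A (of_real (q - 1)) n * (exp (- (\<i> * \<theta> n * of_real m))
       * (tilted_base (q / (q - 1)) (\<theta> n))\<^sup>2 / tilted_base (q / (q - 2)) (\<theta> n)) ^ n
      = exp (- (\<i> * \<theta> n * of_real m)) ^ n * ballot_poly (p n) n / ballot_poly (of_real q - 1) n) sequentially"
    proof -
      have "eventually (\<lambda>n. p n \<noteq> 0) sequentially" "eventually (\<lambda>n. p n \<noteq> 1) sequentially"
        using tendsto_imp_eventually_ne[OF p, of 0] tendsto_imp_eventually_ne[OF p, of 1] assms(1)
        by (simp_all only: of_real_eq_0_iff of_real_eq_1_iff)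
      then show ?thesis
      proof eventually_elim
        case (elim n)
        have a: "tilted_base (q / (q - 1)) (\<theta> n) = p n / of_real (q - 1)"
          using assms(1) by (simp add: tilted_base_def p_def field_simps)
        have "complex_of_real q \<noteq> 2"
          using of_real_eq_iff[of q 2, where 'a = complex] assms(1) by simp
        then have b: "tilted_base (q / (q - 2)) (\<theta> n) = (p n - 1) / of_real (q - 2)"
          by (simp add: tilted_base_def p_def field_simps)
        have r: "complex_of_real (q - 1) \<noteq> 0" "complex_of_real (q - 2) \<noteq> 0"
          "of_real (q - 1) - 1 = complex_of_real (q - 2)"
          unfolding of_real_eq_0_iff using assms(1) by simp_all
        \<comment> \<open>\<open>X\<close> and \<open>Y\<close> normalise the partition functions at
          \<open>p n\<close> and \<open>q - 1\<close>; the tilt \<open>W\<close> converts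
          \<open>X\<close> into \<open>Y\<close>.\<close>
        define X Y W where "X = (p n - 1) / (p n)\<^sup>2"
          and "Y = (complex_of_real (q - 1) - 1) / (of_real (q - 1))\<^sup>2"
          and "W = (tilted_base (q / (q - 1)) (\<theta> n))\<^sup>2 / tilted_base (q / (q - 2)) (\<theta> n)"
        have "Y \<noteq> 0" unfolding Y_def r(3) using r by simp
        moreover have "X * W = Y"
          unfolding X_def Y_def W_def a b r(3) using r elim by (simp add: power_divide)
        ultimately have XW: "X ^ n * W ^ n = Y ^ n" "Y ^ n \<noteq> 0" by (simp_all flip: power_mult_distrib)
        have "?A (p n) n / ?A (of_real (q - 1)) n * (exp (- (\<i> * \<theta> n * of_real m)) * W) ^ n
          = ballot_poly (p n) n * (X ^ n * W ^ n) / (ballot_poly (of_real (q - 1)) n * Y ^ n)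
              * exp (- (\<i> * \<theta> n * of_real m)) ^ n"
          by (simp add: X_def Y_def power_mult_distrib)
        also have "\<dots> = exp (- (\<i> * \<theta> n * of_real m)) ^ n * ballot_poly (p n) n / ballot_poly (of_real q - 1) n"
          unfolding XW(1) using XW(2) by simp
        finally show ?case by (simp add: W_def)
      qed
    qed
    ultimately have "(\<lambda>n. exp (- (\<i> * \<theta> n * of_real m)) ^ n * ballot_poly (p n) n / ballot_poly (of_real q - 1) n)
       \<longlonglongrightarrow> K / K * of_real (exp (- t\<^sup>2 / 2))"
      by (rule Lim_transform_eventually)
    then show "(\<lambda>n. exp (- (\<i> * complex_of_real (t / sqrt (v * real n)) * complex_of_real m)) ^ n *
          ballot_poly (complex_of_real q * exp (\<i> * complex_of_real (t / sqrt (v * real n))) - 1) n /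
          ballot_poly (complex_of_real q - 1) n) \<longlonglongrightarrow> complex_of_real (exp (- (t\<^sup>2) / 2))"
      using \<open>K \<noteq> 0\<close> by (simp add: p_def \<theta>_def)
  qed
qed

end
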